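(* Let $0<a<\frac13$ and let $G:\mathbb{T}^2\to\mathbb{T}^2$, $\mathbb{T}^2=\mathbb{R}^2/(2\pi\mathbb{Z})^2$, be the diffeomorphism induced by $$G(x,y)=\bigl(x+2a\sin x+a\sin y+a\sin(x-y),\; y+a\sin x+2a\sin y+a\sin(y-x)\bigr)\pmod{2\pi}.$$ Then $G$ is Morse-Smale. Its nonwandering set $\Omega(G)$ consists of six hyperbolic fixed points: three saddles, $(0,\pi)$, $(\pi,0)$, $(\pi,\pi)$; two sinks, $(\frac{2\pi}{3},\frac{4\pi}{3})$, $(\frac{4\pi}{3},\frac{2\pi}{3})$; and one source, $(0,0)$.
   Context: A $C^1$ diffeomorphism $f$ of a compact smooth manifold $M$ is Morse-Smale if: (1) its nonwandering set $\Omega(f)$ consists of a finite number of fixed points or periodic orbits, all hyperbolic; (2) for all $x\in M$ the limit sets of the orbit $\{f^n(x)\}_{n\in\mathbb{Z}}$ are either a fixed point or a periodic orbit; (3) the stable and unstable manifolds of all fixed points and periodic orbits intersect transversely. A sink (source) is a hyperbolic fixed point at which all eigenvalues of the derivative have modulus less than 1 (greater than 1); a saddle is a hyperbolic fixed point that is neither. *)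

theory Defs
  imports "HOL-Analysis.Analysis"
begin

section \<open>Topological dynamics\<close>

definition periodic_point :: "('a \<Rightarrow> 'a) \<Rightarrow> 'a \<Rightarrow> bool" where
  "periodic_point f p \<longleftrightarrow> (\<exists>n>0. (f ^^ n) p = p)"

definition period :: "('a \<Rightarrow> 'a) \<Rightarrow> 'a \<Rightarrow> nat" where
  "period f p = (LEAST n. n > 0 \<and> (f ^^ n) p = p)"

definition forward_orbit :: "('a \<Rightarrow> 'a) \<Rightarrow> 'a \<Rightarrow> 'a set" where
  "forward_orbit f x = range (\<lambda>n. (f ^^ n) x)"

definition nonwandering_set :: "('a::topological_space \<Rightarrow> 'a) \<Rightarrow> 'a set" where
  "nonwandering_set f =
     {x. \<forall>U. open U \<and> x \<in> U \<longrightarrow> (\<exists>n>0. (f ^^ n) ` U \<inter> U \<noteq> {})}"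

definition omega_limit_set :: "('a::topological_space \<Rightarrow> 'a) \<Rightarrow> 'a \<Rightarrow> 'a set" where
  "omega_limit_set f x = (\<Inter>N. closure {(f ^^ n) x | n. n \<ge> N})"

definition alpha_limit_set :: "('a::topological_space \<Rightarrow> 'a) \<Rightarrow> 'a \<Rightarrow> 'a set" where
  "alpha_limit_set f = omega_limit_set (inv f)"

definition stable_manifold :: "('a::topological_space \<Rightarrow> 'a) \<Rightarrow> 'a \<Rightarrow> 'a set" where
  "stable_manifold f p = {x. (\<lambda>k. (f ^^ (k * period f p)) x) \<longlonglongrightarrow> p}"

definition unstable_manifold :: "('a::topological_space \<Rightarrow> 'a) \<Rightarrow> 'a \<Rightarrow> 'a set" where
  "unstable_manifold f = stable_manifold (inv f)"


section \<open>The two-dimensional torus\<close>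

definition lattice_equiv :: "real^2 \<Rightarrow> real^2 \<Rightarrow> bool" where
  "lattice_equiv v w \<longleftrightarrow> (\<forall>i. \<exists>k::int. v $ i = w $ i + 2 * pi * of_int k)"

lemma equivp_lattice_equiv: "equivp lattice_equiv"
proof (rule equivpI)
  show "reflp lattice_equiv"
    unfolding reflp_def lattice_equiv_def by (auto intro: exI[of _ 0])
  show "symp lattice_equiv"
    unfolding symp_def lattice_equiv_def
  proof (intro allI impI)
    fix v w :: "real^2" and i
    assume "\<forall>i. \<exists>k::int. v $ i = w $ i + 2 * pi * of_int k"
    then obtain k :: int where "v $ i = w $ i + 2 * pi * of_int k" by blast
    then have "w $ i = v $ i + 2 * pi * of_int (- k)" by simp
    then show "\<exists>k::int. w $ i = v $ i + 2 * pi * of_int k" by blast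
  qed
  show "transp lattice_equiv"
    unfolding transp_def lattice_equiv_def
  proof (intro allI impI)
    fix u v w :: "real^2" and i
    assume "\<forall>i. \<exists>k::int. u $ i = v $ i + 2 * pi * of_int k"
      and "\<forall>i. \<exists>k::int. v $ i = w $ i + 2 * pi * of_int k"
    then obtain k l :: int where "u $ i = v $ i + 2 * pi * of_int k"
      and "v $ i = w $ i + 2 * pi * of_int l" by blast
    then have "u $ i = w $ i + 2 * pi * of_int (k + l)" by (simp add: algebra_simps)
    then show "\<exists>k::int. u $ i = w $ i + 2 * pi * of_int k" by blast
  qed
qed

quotient_type torus = "real^2" / lattice_equiv
  by (rule equivp_lattice_equiv)

lift_definition torus_proj :: "real^2 \<Rightarrow> torus" is "\<lambda>v. v" .

instantiation torus :: topological_space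
begin

definition open_torus :: "torus set \<Rightarrow> bool" where
  "open_torus U \<longleftrightarrow> open (torus_proj -` U)"

instance
  by standard (auto simp: open_torus_def vimage_Union)

end


section \<open>Differentiable maps and curves on the torus\<close>

text \<open>Every tangent space of the torus is identified with the plane by means of the
  derivative of \<^const>\<open>torus_proj\<close>, whose local inverses are the charts. Accordingly a map
  into the torus is differentiated through a lift near the base point; two such lifts
  differ near that point by a constant lattice vector, so the derivative is unique.\<close>

definition has_lifted_derivative ::
  "('b::real_normed_vector \<Rightarrow> torus) \<Rightarrow> ('b \<Rightarrow> real^2) \<Rightarrow> 'b \<Rightarrow> bool" where
  "has_lifted_derivative h L v \<longleftrightarrow>
     (\<exists>H. (\<forall>\<^sub>F w in nhds v. torus_proj (H w) = h w) \<and> (H has_derivative L) (at v))"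

definition torus_has_derivative ::
  "(torus \<Rightarrow> torus) \<Rightarrow> (real^2 \<Rightarrow> real^2) \<Rightarrow> torus \<Rightarrow> bool" where
  "torus_has_derivative f L p \<longleftrightarrow>
     (\<exists>v. torus_proj v = p \<and> has_lifted_derivative (\<lambda>w. f (torus_proj w)) L v)"

definition torus_C1 :: "(torus \<Rightarrow> torus) \<Rightarrow> bool" where
  "torus_C1 f \<longleftrightarrow>
     (\<exists>D :: torus \<Rightarrow> (real^2) \<Rightarrow>\<^sub>L (real^2). continuous_on UNIV D \<and>
        (\<forall>p. torus_has_derivative f (blinfun_apply (D p)) p))"

definition torus_C1_diffeo :: "(torus \<Rightarrow> torus) \<Rightarrow> bool" where
  "torus_C1_diffeo f \<longleftrightarrow> bij f \<and> torus_C1 f \<and> torus_C1 (inv f)"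

text \<open>\<open>C1_curve_on \<epsilon> \<gamma> \<gamma>'\<close>: on the interval around 0 of radius \<open>\<epsilon>\<close>, the curve \<open>\<gamma>\<close> is
  continuously differentiable with velocity \<open>\<gamma>'\<close>.\<close>

definition C1_curve_on :: "real \<Rightarrow> (real \<Rightarrow> torus) \<Rightarrow> (real \<Rightarrow> real^2) \<Rightarrow> bool" where
  "C1_curve_on \<epsilon> \<gamma> \<gamma>' \<longleftrightarrow>
     continuous_on {-\<epsilon><..<\<epsilon>} \<gamma>' \<and>
     (\<forall>t\<in>{-\<epsilon><..<\<epsilon>}. has_lifted_derivative \<gamma> (\<lambda>s. s *\<^sub>R \<gamma>' t) t)"


section \<open>Hyperbolicity\<close>

definition complex_eigenvalues :: "(real^2 \<Rightarrow> real^2) \<Rightarrow> complex set" where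
  "complex_eigenvalues L =
     {c. \<exists>z::complex^2. z \<noteq> 0 \<and> map_matrix complex_of_real (matrix L) *v z = c *s z}"

definition multipliers :: "(torus \<Rightarrow> torus) \<Rightarrow> torus \<Rightarrow> complex set" where
  "multipliers f p = {c. \<exists>L. torus_has_derivative f L p \<and> c \<in> complex_eigenvalues L}"

definition hyperbolic_fixed_point :: "(torus \<Rightarrow> torus) \<Rightarrow> torus \<Rightarrow> bool" where
  "hyperbolic_fixed_point f p \<longleftrightarrow>
     f p = p \<and> (\<exists>L. torus_has_derivative f L p) \<and> (\<forall>c\<in>multipliers f p. cmod c \<noteq> 1)"

definition hyperbolic_periodic_point :: "(torus \<Rightarrow> torus) \<Rightarrow> torus \<Rightarrow> bool" where
  "hyperbolic_periodic_point f p \<longleftrightarrow>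
     periodic_point f p \<and> hyperbolic_fixed_point (f ^^ period f p) p"

definition is_sink :: "(torus \<Rightarrow> torus) \<Rightarrow> torus \<Rightarrow> bool" where
  "is_sink f p \<longleftrightarrow> hyperbolic_fixed_point f p \<and> (\<forall>c\<in>multipliers f p. cmod c < 1)"

definition is_source :: "(torus \<Rightarrow> torus) \<Rightarrow> torus \<Rightarrow> bool" where
  "is_source f p \<longleftrightarrow> hyperbolic_fixed_point f p \<and> (\<forall>c\<in>multipliers f p. cmod c > 1)"

definition is_saddle :: "(torus \<Rightarrow> torus) \<Rightarrow> torus \<Rightarrow> bool" where
  "is_saddle f p \<longleftrightarrow> hyperbolic_fixed_point f p \<and> \<not> is_sink f p \<and> \<not> is_source f p"


section \<open>Transversality and Morse-Smale diffeomorphisms\<close>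

text \<open>The stable manifold of a hyperbolic periodic point \<open>p\<close> is the increasing union of the preimages of a local stable
  manifold under iterates of the return map at \<open>p\<close>, and it carries the resulting structure of
  an immersed (in general not embedded) submanifold. Its tangent vectors at \<open>x\<close> are the
  velocities of the continuously differentiable curves through \<open>x\<close> that lie locally inside
  one of these preimages, and not merely in the set \<^const>\<open>stable_manifold\<close>. A curve does so
  exactly if, near 0, its points converge to \<open>p\<close> uniformly under the return map; this is the
  last conjunct below.\<close>

definition stable_tangent_space ::
  "(torus \<Rightarrow> torus) \<Rightarrow> torus \<Rightarrow> torus \<Rightarrow> (real^2) set" where
  "stable_tangent_space f p x =
     {u. \<exists>\<epsilon>>0. \<exists>\<gamma> \<gamma>'. C1_curve_on \<epsilon> \<gamma> \<gamma>' \<and> \<gamma> 0 = x \<and> \<gamma>' 0 = u \<and>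
        (\<forall>U. open U \<and> p \<in> U \<longrightarrow>
           (\<forall>\<^sub>F k in sequentially. \<forall>t\<in>{-\<epsilon><..<\<epsilon>}. (f ^^ (k * period f p)) (\<gamma> t) \<in> U))}"

definition unstable_tangent_space ::
  "(torus \<Rightarrow> torus) \<Rightarrow> torus \<Rightarrow> torus \<Rightarrow> (real^2) set" where
  "unstable_tangent_space f = stable_tangent_space (inv f)"

definition transverse_stable_unstable :: "(torus \<Rightarrow> torus) \<Rightarrow> torus \<Rightarrow> torus \<Rightarrow> bool" where
  "transverse_stable_unstable f p q \<longleftrightarrow>
     (\<forall>x \<in> stable_manifold f p \<inter> unstable_manifold f q.
        {u + w | u w. u \<in> stable_tangent_space f p x \<and> w \<in> unstable_tangent_space f q x} = UNIV)"

text \<open>The stable manifold of a periodic orbit is the union of those of its points, so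
  transversality is required for all pairs of periodic points, fixed points included.\<close>

definition morse_smale :: "(torus \<Rightarrow> torus) \<Rightarrow> bool" where
  "morse_smale f \<longleftrightarrow>
     torus_C1_diffeo f \<and>
     (\<exists>P. finite P \<and> (\<forall>p\<in>P. hyperbolic_periodic_point f p) \<and>
          nonwandering_set f = (\<Union>p\<in>P. forward_orbit f p)) \<and>
     (\<forall>x. (\<exists>p. periodic_point f p \<and> omega_limit_set f x = forward_orbit f p) \<and>
          (\<exists>q. periodic_point f q \<and> alpha_limit_set f x = forward_orbit f q)) \<and>
     (\<forall>p q. periodic_point f p \<and> periodic_point f q \<longrightarrow> transverse_stable_unstable f p q)"


section \<open>The map\<close>

definition G_lift :: "real \<Rightarrow> real^2 \<Rightarrow> real^2" where
  "G_lift a v = (let x = v $ 1; y = v $ 2 in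
     vector [x + 2 * a * sin x + a * sin y + a * sin (x - y),
             y + a * sin x + 2 * a * sin y + a * sin (y - x)])"

lemma sin_add_2pi_int: "sin (x + 2 * pi * of_int k) = sin (x::real)"
  by (simp add: sin_add sin_int_2pin cos_int_2pin)

lemma lattice_equiv_G_lift:
  assumes "lattice_equiv v w"
  shows "lattice_equiv (G_lift a v) (G_lift a w)"
proof -
  obtain k l :: int where
    k: "v $ 1 = w $ 1 + 2 * pi * of_int k" and l: "v $ 2 = w $ 2 + 2 * pi * of_int l"
    using assms unfolding lattice_equiv_def by blast
  have d: "v $ 1 - v $ 2 = (w $ 1 - w $ 2) + 2 * pi * of_int (k - l)"
    "v $ 2 - v $ 1 = (w $ 2 - w $ 1) + 2 * pi * of_int (l - k)"
    using k l by (simp_all add: algebra_simps)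
  have s: "sin (v $ 1) = sin (w $ 1)" "sin (v $ 2) = sin (w $ 2)"
    "sin (v $ 1 - v $ 2) = sin (w $ 1 - w $ 2)" "sin (v $ 2 - v $ 1) = sin (w $ 2 - w $ 1)"
    unfolding d unfolding k l by (rule sin_add_2pi_int)+
  have "G_lift a v $ 1 = G_lift a w $ 1 + 2 * pi * of_int k"
    "G_lift a v $ 2 = G_lift a w $ 2 + 2 * pi * of_int l"
    by (simp_all add: G_lift_def Let_def s vector_2) (simp_all add: k l)
  then show ?thesis
    unfolding lattice_equiv_def forall_2 by blast
qed

lift_definition G_map :: "real \<Rightarrow> torus \<Rightarrow> torus" is G_lift
  by (rule lattice_equiv_G_lift)

abbreviation torus_pt :: "real \<Rightarrow> real \<Rightarrow> torus" where
  "torus_pt x y \<equiv> torus_proj (vector [x, y])"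

lemma G_map_torus_pt:
  "G_map a (torus_pt x y) =
     torus_pt (x + 2 * a * sin x + a * sin y + a * sin (x - y))
              (y + a * sin x + 2 * a * sin y + a * sin (y - x))"
  by transfer (simp add: G_lift_def Let_def vector_2 equivp_reflp[OF equivp_lattice_equiv])

end

theory Submission
  imports Defs
begin

text \<open>The map is one Euler step \<open>v + a *\<^sub>R A (\<nabla>\<Phi> v)\<close> of a gradient flow, where
  \<open>\<Phi> (x, y) = - cos x - cos y - cos (x - y)\<close> and \<open>A\<close> is the matrix with rows \<open>(2, 1)\<close> and \<open>(1, 2)\<close>.
  In the norm whose square is \<open>x\<^sup>2 + y\<^sup>2 + (x - y)\<^sup>2\<close>, a multiple of the form given by the inverse of \<open>A\<close>,
  the drift \<open>A (\<nabla>\<Phi>)\<close> has Lipschitz constant 3. Hence for \<open>a < 1 / 3\<close> the lift of the map to the plane is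
  a diffeomorphism, and \<open>\<Phi>\<close> increases strictly along nonconstant orbits, so that only the zeros of the
  drift are nonwandering. Along an orbit the drift and the steps tend to 0, which forces convergence
  to a single zero because the zeros lie in a lattice. The potential is \<open>- 3\<close> at the source, 1 at the saddles
  and \<open>3 / 2\<close> at the sinks, so no orbit connects two distinct saddles. At a saddle itself, transversality
  follows from two straight lines through it that the map preserves.\<close>

section \<open>Elementary estimates for sine and cosine\<close>

lemma vector2_eq_axis: "(vector [x, y] :: real^2) = x *\<^sub>R axis 1 1 + y *\<^sub>R axis 2 1"
  by (simp add: vec_eq_iff forall_2 axis_def)

lemma abs_sin_diff_le: "\<bar>sin x - sin y\<bar> \<le> \<bar>x - y\<bar>" for x y :: real
proof -
  have "\<bar>sin x - sin y\<bar> = 2 * \<bar>sin ((x - y) / 2)\<bar> * \<bar>cos ((x + y) / 2)\<bar>"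
    by (simp add: sin_diff_sin abs_mult)
  also have "\<dots> \<le> 2 * \<bar>(x - y) / 2\<bar> * 1"
    by (intro mult_mono abs_sin_x_le_abs_x) auto
  finally show ?thesis by simp
qed

text \<open>The function \<open>x\<^sup>2 / 2 - cos x\<close> is convex, its second derivative being
  \<open>1 + cos x\<close>, so its graph lies above each tangent. The bound holds for every
  \<open>s\<close>, so it applies to a full step of the map.\<close>

lemma cos_add_le_tangent: "cos (x + s) \<le> cos x - s * sin x + s\<^sup>2 / 2" for x s :: real
proof -
  have "convex_on UNIV (\<lambda>x::real. x\<^sup>2 / 2 - cos x)"
  proof (rule f''_ge0_imp_convex)
    show "((\<lambda>x. x\<^sup>2 / 2 - cos x) has_real_derivative (x + sin x)) (at x)" for x :: real
      by (auto intro!: derivative_eq_intros)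
    show "((\<lambda>x. x + sin x) has_real_derivative (1 + cos x)) (at x)" for x :: real
      by (auto intro!: derivative_eq_intros)
    show "0 \<le> 1 + cos x" for x :: real
      using cos_ge_minus_one[of x] by linarith
  qed auto
  moreover have "((\<lambda>x. x\<^sup>2 / 2 - cos x) has_real_derivative (x + sin x)) (at x within UNIV)"
    by (auto intro!: derivative_eq_intros)
  ultimately have "((x + s)\<^sup>2 / 2 - cos (x + s)) - (x\<^sup>2 / 2 - cos x) \<ge> (x + sin x) * ((x + s) - x)"
    by (intro convex_on_imp_above_tangent) auto
  then show ?thesis by (simp add: power2_eq_square field_simps)
qed

text \<open>The zeros of sine are spaced by pi. A sequence whose sine tends to 0 approaches them,
  and steps tending to 0 eventually rule out a change of the nearest zero.\<close>

lemma convergent_of_sin_tendsto_0: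
  fixes x :: "nat \<Rightarrow> real"
  assumes "(\<lambda>n. sin (x n)) \<longlonglongrightarrow> 0" and "(\<lambda>n. x (Suc n) - x n) \<longlonglongrightarrow> 0"
  shows "convergent x"
proof -
  define k where "k n = round (x n / pi)" for n
  have near: "\<bar>x n - of_int (k n) * pi\<bar> \<le> pi / 2" for n
  proof -
    have "\<bar>of_int (k n) - x n / pi\<bar> \<le> 1 / 2"
      unfolding k_def by (rule of_int_round_abs_le)
    then have "\<bar>of_int (k n) - x n / pi\<bar> * pi \<le> 1 / 2 * pi" by (intro mult_right_mono) auto
    then show ?thesis by (simp add: abs_mult_pos left_diff_distrib abs_minus_commute)
  qed
  have sin_eq: "\<bar>sin (x n - of_int (k n) * pi)\<bar> = \<bar>sin (x n)\<bar>" for n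
  proof -
    have "sin (of_int (k n) * pi) = 0" by (metis sin_zero_iff_int2)
    moreover from this have "\<bar>cos (of_int (k n) * pi)\<bar> = 1"
      using sin_zero_abs_cos_one by blast
    ultimately show ?thesis by (simp add: sin_diff abs_mult)
  qed
  have lim: "(\<lambda>n. x n - of_int (k n) * pi) \<longlonglongrightarrow> 0"
  proof -
    have "(\<lambda>n. sin (x n - of_int (k n) * pi)) \<longlonglongrightarrow> 0"
      by (rule tendsto_rabs_zero_cancel) (use tendsto_rabs_zero[OF assms(1)] sin_eq in simp)
    \<comment> \<open>By \<open>near\<close> the deviations lie where \<open>arcsin\<close> inverts
      sine, so continuity of \<open>arcsin\<close> turns small sines into small deviations.\<close>
    then have "(\<lambda>n. arcsin (sin (x n - of_int (k n) * pi))) \<longlonglongrightarrow> arcsin 0"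
      by (intro isCont_tendsto_compose[OF isCont_arcsin]) auto
    moreover have "arcsin (sin (x n - of_int (k n) * pi)) = x n - of_int (k n) * pi" for n
      using abs_le_D1[OF near[of n]] abs_le_D2[OF near[of n]] by (intro arcsin_sin) simp_all
    ultimately show ?thesis by simp
  qed
  \<comment> \<open>The jump between consecutive nearest zeros is the step up to deviations that
    tend to 0. Being an integer multiple of pi, it vanishes once it is below pi in modulus.\<close>
  have "(\<lambda>n. (x (Suc n) - x n) - (x (Suc n) - of_int (k (Suc n)) * pi)
           + (x n - of_int (k n) * pi)) \<longlonglongrightarrow> 0 - 0 + 0"
    by (intro tendsto_intros assms(2) lim LIMSEQ_Suc)
  then have "(\<lambda>n. of_int (k (Suc n) - k n) * pi) \<longlonglongrightarrow> 0"
    by (simp add: algebra_simps)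
  then have "\<forall>\<^sub>F n in sequentially. \<bar>of_int (k (Suc n) - k n) * pi\<bar> < pi"
    using pi_gt_zero order_tendstoD(2) tendsto_rabs_zero by blast
  then obtain N where N: "\<And>n. n \<ge> N \<Longrightarrow> \<bar>of_int (k (Suc n) - k n) * pi\<bar> < pi"
    by (auto simp: eventually_sequentially)
  have stable: "k (Suc n) = k n" if "n \<ge> N" for n
  proof -
    have "\<bar>of_int (k (Suc n) - k n)\<bar> * pi < 1 * pi" using N[OF that] by (simp add: abs_mult)
    then have "\<bar>of_int (k (Suc n) - k n)\<bar> < (1::real)" by (simp only: mult_less_cancel_right) auto
    then show ?thesis by linarith
  qed
  have const: "k n = k N" if "n \<ge> N" for n
    using that by (induction n rule: dec_induct) (simp_all add: stable)
  have "(\<lambda>n. (x n - of_int (k n) * pi) + of_int (k N) * pi) \<longlonglongrightarrow> 0 + of_int (k N) * pi"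
    by (intro tendsto_intros lim)
  moreover have "\<forall>\<^sub>F n in sequentially. (x n - of_int (k n) * pi) + of_int (k N) * pi = x n"
  proof (rule eventually_sequentiallyI)
    show "(x n - of_int (k n) * pi) + of_int (k N) * pi = x n" if "n \<ge> N" for n
      unfolding const[OF that] by simp
  qed
  ultimately have "x \<longlonglongrightarrow> 0 + of_int (k N) * pi"
    using Lim_transform_eventually by blast
  then show ?thesis by (auto simp: convergent_def)
qed

section \<open>The gradient structure of the lift\<close>

definition hex_form :: "real^2 \<Rightarrow> real" where
  "hex_form v = (v $ 1)\<^sup>2 + (v $ 2)\<^sup>2 + (v $ 1 - v $ 2)\<^sup>2"

text \<open>This is the matrix with rows (2, 1) and (1, 2) applied to the gradient (sin x + sin (x -
  y), sin y - sin (x - y)) of \<open>potential\<close>.\<close>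

definition drift :: "real^2 \<Rightarrow> real^2" where
  "drift v = vector [2 * sin (v $ 1) + sin (v $ 2) + sin (v $ 1 - v $ 2),
                     sin (v $ 1) + 2 * sin (v $ 2) - sin (v $ 1 - v $ 2)]"

definition potential :: "real^2 \<Rightarrow> real" where
  "potential v = - cos (v $ 1) - cos (v $ 2) - cos (v $ 1 - v $ 2)"

lemma G_lift_eq: "G_lift a v = v + a *\<^sub>R drift v"
proof -
  have "sin (v $ 2 - v $ 1) = - sin (v $ 1 - v $ 2)" by (metis minus_diff_eq sin_minus)
  then show ?thesis
    by (simp add: G_lift_def drift_def Let_def vec_eq_iff forall_2 algebra_simps)
qed

lemma norm_sq_le_hex_form: "(norm v)\<^sup>2 \<le> hex_form v"
  by (simp add: hex_form_def norm_vec_def L2_set_def sum_2)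

lemma hex_form_le_norm_sq: "hex_form v \<le> 3 * (norm v)\<^sup>2"
  using sum_power2_ge_zero[of "v $ 1 + v $ 2" 0]
  by (simp add: hex_form_def norm_vec_def L2_set_def sum_2 power2_eq_square algebra_simps)

text \<open>The form of the combination falls short of 9 times the sum of the squares by 3 times a
  square. With sine increments for \<open>p\<close>, \<open>q\<close>, \<open>r\<close> this gives
  the Lipschitz bound on the drift; with multiples by cosines it gives the bound on its
  derivative.\<close>

lemma hex_form_combination_le:
  assumes "p\<^sup>2 \<le> (d $ 1)\<^sup>2" and "q\<^sup>2 \<le> (d $ 2)\<^sup>2" and "r\<^sup>2 \<le> (d $ 1 - d $ 2)\<^sup>2"
  shows "hex_form (vector [2 * p + q + r, p + 2 * q - r]) \<le> 9 * hex_form d"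
proof -
  have "hex_form (vector [2 * p + q + r, p + 2 * q - r]) =
      9 * (p\<^sup>2 + q\<^sup>2 + r\<^sup>2) - 3 * (p - q - r)\<^sup>2"
    by (simp add: hex_form_def power2_eq_square algebra_simps)
  also have "\<dots> \<le> 9 * (p\<^sup>2 + q\<^sup>2 + r\<^sup>2)" by simp
  also have "\<dots> \<le> 9 * hex_form d" using assms by (simp add: hex_form_def)
  finally show ?thesis .
qed

lemma hex_form_drift_diff_le: "hex_form (drift v - drift w) \<le> 9 * hex_form (v - w)"
proof -
  let ?p = "sin (v $ 1) - sin (w $ 1)" and ?q = "sin (v $ 2) - sin (w $ 2)"
  let ?r = "sin (v $ 1 - v $ 2) - sin (w $ 1 - w $ 2)"
  have "drift v - drift w = vector [2 * ?p + ?q + ?r, ?p + 2 * ?q - ?r]"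
    by (simp add: drift_def vec_eq_iff forall_2)
  moreover have "?p\<^sup>2 \<le> ((v - w) $ 1)\<^sup>2" "?q\<^sup>2 \<le> ((v - w) $ 2)\<^sup>2"
    using abs_sin_diff_le by (simp_all add: abs_le_square_iff)
  moreover have "?r\<^sup>2 \<le> ((v - w) $ 1 - (v - w) $ 2)\<^sup>2"
    using abs_sin_diff_le[of "v $ 1 - v $ 2" "w $ 1 - w $ 2"]
    by (simp add: abs_le_square_iff algebra_simps)
  ultimately show ?thesis using hex_form_combination_le by metis
qed

text \<open>This is the reverse triangle inequality for the norm given by \<open>hex_form\<close>,
  obtained from an identity with two nonnegative terms instead of square roots.\<close>

lemma hex_form_expansion_ge:
  assumes "hex_form e \<le> 9 * hex_form d" and "0 \<le> a" and "a \<le> 1 / 3"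
  shows "(1 - 3 * a)\<^sup>2 * hex_form d \<le> hex_form (d + a *\<^sub>R e)"
proof -
  have nonneg: "0 \<le> hex_form w" for w by (simp add: hex_form_def)
  have "hex_form (d + a *\<^sub>R e) - (1 - 3 * a)\<^sup>2 * hex_form d =
      a / 3 * hex_form (3 *\<^sub>R d + e) + a * (1 - 3 * a) / 3 * (9 * hex_form d - hex_form e)"
    by (simp add: hex_form_def power2_eq_square field_simps)
  moreover have "0 \<le> a / 3 * hex_form (3 *\<^sub>R d + e)"
    using assms nonneg by (intro mult_nonneg_nonneg) auto
  moreover have "0 \<le> a * (1 - 3 * a) / 3 * (9 * hex_form d - hex_form e)"
    using assms by (intro mult_nonneg_nonneg) auto
  ultimately show ?thesis by linarith
qed

text \<open>Each cosine is expanded to second order. The linear part gains \<open>a / 3\<close>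
  times the form of the drift, the quadratic part loses at most \<open>a\<^sup>2 / 2\<close> times
  it.\<close>

lemma potential_G_lift_ge:
  "potential (G_lift a v) \<ge> potential v + (a / 3 - a\<^sup>2 / 2) * hex_form (drift v)"
proof -
  let ?h = "a *\<^sub>R drift v"
  let ?x = "v $ 1" and ?y = "v $ 2"
  have "cos (?x + ?h $ 1) \<le> cos ?x - ?h $ 1 * sin ?x + (?h $ 1)\<^sup>2 / 2"
    "cos (?y + ?h $ 2) \<le> cos ?y - ?h $ 2 * sin ?y + (?h $ 2)\<^sup>2 / 2"
    "cos ((?x - ?y) + (?h $ 1 - ?h $ 2)) \<le>
      cos (?x - ?y) - (?h $ 1 - ?h $ 2) * sin (?x - ?y) + (?h $ 1 - ?h $ 2)\<^sup>2 / 2"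
    by (rule cos_add_le_tangent)+
  then have "potential (G_lift a v) \<ge> potential v
      + (?h $ 1 * sin ?x + ?h $ 2 * sin ?y + (?h $ 1 - ?h $ 2) * sin (?x - ?y)) - hex_form ?h / 2"
    unfolding potential_def G_lift_eq hex_form_def
    by (simp add: algebra_simps add_divide_distrib)
  \<comment> \<open>The left side pairs the step with the gradient, which is the inverse matrix
    applied to the drift; \<open>hex_form\<close> is three times the quadratic form of that
    inverse.\<close>
  moreover have "?h $ 1 * sin ?x + ?h $ 2 * sin ?y + (?h $ 1 - ?h $ 2) * sin (?x - ?y) =
      a / 3 * hex_form (drift v)"
    by (simp add: hex_form_def drift_def power2_eq_square field_simps)
  moreover have "hex_form ?h = a\<^sup>2 * hex_form (drift v)"
    by (simp add: hex_form_def power2_eq_square algebra_simps)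
  ultimately show ?thesis by (simp add: algebra_simps)
qed

text \<open>The six zeros of the drift are nondegenerate, so \<open>sin (3 * x)\<close> lies in the ideal that the two
  components of the gradient of the potential generate among the trigonometric polynomials.\<close>

lemma sin_triple_eq_gradient_combination:
  fixes x y :: real
  defines "u \<equiv> sin x + sin (x - y)" and "w \<equiv> sin y - sin (x - y)"
  shows "sin (3 * x) = u * (4 * (cos x)\<^sup>2 - 1) - (2 * cos x - 1) *
    (u * (cos y + cos (x - y) - 1) + w * (cos (x - y) - cos x - 1))"
proof -
  define t where "t = sin (x - y)"
  define c where "c = cos (x - y)"
  have e1: "sin x = t * cos y + c * sin y" using sin_add[of "x - y" y] by (simp add: t_def c_def)
  have e2: "t = sin x * cos y - cos x * sin y" by (simp add: t_def sin_diff)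
  have e3: "sin y = sin x * c - cos x * t" using sin_diff[of x "x - y"] by (simp add: t_def c_def)
  define E where "E = u * (cos y + c - 1) + w * (c - cos x - 1)"
  have su: "sin x = u - t" "sin y = w + t" by (simp_all add: u_def w_def t_def)
  \<comment> \<open>Equivalently \<open>E = t * (2 * cos x + 1)\<close>, by the three addition
    formulas. Multiplying by \<open>2 * cos x - 1\<close> produces the factor of the triple angle
    formula.\<close>
  have tc: "2 * (t * cos x) = E - t"
    using e1 e2 e3 unfolding E_def su by (simp add: algebra_simps)
  have "t * (4 * (cos x)\<^sup>2 - 1) = 2 * cos x * (2 * (t * cos x)) - t"
    by (simp add: power2_eq_square algebra_simps)
  also have "\<dots> = E * (2 * cos x - 1)"
    unfolding tc using tc by (simp add: algebra_simps)
  finally have *: "t * (4 * (cos x)\<^sup>2 - 1) = E * (2 * cos x - 1)" .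
  have "sin (3 * x) = sin x * (4 * (cos x)\<^sup>2 - 1)"
  proof -
    have "sin (3 * x) = sin (2 * x + x)" by (simp add: algebra_simps)
    also have "\<dots> = sin x * (4 * (cos x)\<^sup>2 - 1)"
      unfolding sin_add sin_double cos_double_cos by (simp add: power2_eq_square algebra_simps)
    finally show ?thesis .
  qed
  also have "\<dots> = u * (4 * (cos x)\<^sup>2 - 1) - E * (2 * cos x - 1)"
    unfolding su left_diff_distrib * ..
  finally show ?thesis by (simp add: E_def c_def mult.commute)
qed

text \<open>Every cosine factor in the preceding identity has modulus at most 3, whence 12 = 3 + 3 *
  3 and 9 = 3 * 3.\<close>

lemma abs_sin_triple_le:
  fixes x y :: real
  shows "\<bar>sin (3 * x)\<bar> \<le> 12 * \<bar>sin x + sin (x - y)\<bar> + 9 * \<bar>sin y - sin (x - y)\<bar>"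
proof -
  define u w where "u = sin x + sin (x - y)" and "w = sin y - sin (x - y)"
  have c: "\<bar>cos z\<bar> \<le> 1" for z :: real by simp
  have "(cos x)\<^sup>2 \<le> 1" by (simp add: abs_square_le_1)
  then have "\<bar>4 * (cos x)\<^sup>2 - 1\<bar> \<le> 3" using zero_le_power2[of "cos x"] by linarith
  then have 1: "\<bar>u * (4 * (cos x)\<^sup>2 - 1)\<bar> \<le> \<bar>u\<bar> * 3"
    unfolding abs_mult by (intro mult_left_mono) auto
  have b: "\<bar>cos y + cos (x - y) - 1\<bar> \<le> 3" "\<bar>cos (x - y) - cos x - 1\<bar> \<le> 3" "\<bar>2 * cos x - 1\<bar> \<le> 3"
    using c[of x] c[of y] c[of "x - y"] by linarith+
  have "\<bar>u * (cos y + cos (x - y) - 1) + w * (cos (x - y) - cos x - 1)\<bar> \<le>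
      \<bar>u\<bar> * \<bar>cos y + cos (x - y) - 1\<bar> + \<bar>w\<bar> * \<bar>cos (x - y) - cos x - 1\<bar>"
    by (metis abs_mult abs_triangle_ineq)
  also have "\<dots> \<le> \<bar>u\<bar> * 3 + \<bar>w\<bar> * 3" using b by (intro add_mono mult_left_mono) auto
  finally have "\<bar>(2 * cos x - 1) * (u * (cos y + cos (x - y) - 1) + w * (cos (x - y) - cos x - 1))\<bar>
      \<le> 3 * (\<bar>u\<bar> * 3 + \<bar>w\<bar> * 3)"
    unfolding abs_mult using b by (intro mult_mono) auto
  with 1 have "\<bar>u * (4 * (cos x)\<^sup>2 - 1) - (2 * cos x - 1) *
      (u * (cos y + cos (x - y) - 1) + w * (cos (x - y) - cos x - 1))\<bar> \<le> 12 * \<bar>u\<bar> + 9 * \<bar>w\<bar>"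
    by (intro order_trans[OF abs_triangle_ineq4]) simp
  then show ?thesis
    unfolding sin_triple_eq_gradient_combination[of x y] u_def w_def .
qed

lemma gradient_eq_drift:
  "sin (v $ 1) + sin (v $ 1 - v $ 2) = (2 * drift v $ 1 - drift v $ 2) / 3"
  "sin (v $ 2) - sin (v $ 1 - v $ 2) = (2 * drift v $ 2 - drift v $ 1) / 3"
  by (simp_all add: drift_def)

text \<open>At a zero, sin x = - t and sin y = t with t = sin (x - y). The addition formulas then
  show that t annihilates 1 plus the sum of any two of the three cosines; if t is nonzero, all three
  cosines are - 1 / 2.\<close>

lemma drift_eq_0_cases:
  assumes "drift v = 0"
  shows "sin (v $ 1) = 0 \<and> sin (v $ 2) = 0 \<or>
    cos (v $ 1) = - 1 / 2 \<and> cos (v $ 2) = - 1 / 2 \<and> sin (v $ 2) = - sin (v $ 1)"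
proof -
  define x y t c where "x = v $ 1" and "y = v $ 2" and "t = sin (x - y)" and "c = cos (x - y)"
  have s: "sin x = - t" "sin y = t"
    using gradient_eq_drift[of v] assms by (simp_all add: x_def y_def t_def)
  have "sin x = t * cos y + c * sin y" using sin_add[of "x - y" y] by (simp add: t_def c_def)
  then have "t * (cos y + c + 1) = 0" by (simp add: s algebra_simps)
  moreover have "t = sin x * cos y - cos x * sin y" by (simp add: t_def sin_diff)
  then have "t * (cos x + cos y + 1) = 0" by (simp add: s algebra_simps)
  moreover have "sin y = sin x * c - cos x * t" using sin_diff[of x "x - y"] by (simp add: t_def c_def)
  then have "t * (cos x + c + 1) = 0" by (simp add: s algebra_simps)
  ultimately have "t = 0 \<or> cos y + c = -1 \<and> cos x + cos y = -1 \<and> cos x + c = -1" by auto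
  then show ?thesis unfolding x_def[symmetric] y_def[symmetric] s by auto
qed

text \<open>The gradient tends to 0 with the drift and bounds sin (3 x) and sin (3 y), so the
  one-dimensional criterion applies to three times each coordinate.\<close>

lemma convergent_of_drift_tendsto_0:
  fixes v :: "nat \<Rightarrow> real^2"
  assumes drift: "(\<lambda>n. drift (v n)) \<longlonglongrightarrow> 0" and step: "(\<lambda>n. v (Suc n) - v n) \<longlonglongrightarrow> 0"
  shows "convergent v"
proof -
  have d: "(\<lambda>n. drift (v n) $ i) \<longlonglongrightarrow> 0" for i
    using tendsto_vec_nth[OF drift, of i] by simp
  define u w where "u n = sin (v n $ 1) + sin (v n $ 1 - v n $ 2)"
    and "w n = sin (v n $ 2) - sin (v n $ 1 - v n $ 2)" for n
  have "(\<lambda>n. (2 * drift (v n) $ 1 - drift (v n) $ 2) / 3) \<longlonglongrightarrow> (2 * 0 - 0) / 3"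
    "(\<lambda>n. (2 * drift (v n) $ 2 - drift (v n) $ 1) / 3) \<longlonglongrightarrow> (2 * 0 - 0) / 3"
    by (intro tendsto_intros d; simp)+
  then have u: "u \<longlonglongrightarrow> 0" and w: "w \<longlonglongrightarrow> 0"
    unfolding u_def w_def gradient_eq_drift by simp_all
  have b1: "\<bar>sin (3 * v n $ 1)\<bar> \<le> 12 * \<bar>u n\<bar> + 9 * \<bar>w n\<bar>" for n
    unfolding u_def w_def by (rule abs_sin_triple_le)
  have b2: "\<bar>sin (3 * v n $ 2)\<bar> \<le> 12 * \<bar>w n\<bar> + 9 * \<bar>u n\<bar>" for n
  \<comment> \<open>Exchanging the coordinates exchanges \<open>u\<close> and
    \<open>w\<close>.\<close>
  proof -
    have "sin (v n $ 2 - v n $ 1) = - sin (v n $ 1 - v n $ 2)" by (metis minus_diff_eq sin_minus)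
    then show ?thesis
      using abs_sin_triple_le[of "v n $ 2" "v n $ 1"] by (simp add: u_def w_def)
  qed
  have l1: "(\<lambda>n. 12 * \<bar>u n\<bar> + 9 * \<bar>w n\<bar>) \<longlonglongrightarrow> 0"
    using tendsto_add[OF tendsto_mult_left[OF tendsto_rabs_zero[OF u], of 12]
        tendsto_mult_left[OF tendsto_rabs_zero[OF w], of 9]] by simp
  have l2: "(\<lambda>n. 12 * \<bar>w n\<bar> + 9 * \<bar>u n\<bar>) \<longlonglongrightarrow> 0"
    using tendsto_add[OF tendsto_mult_left[OF tendsto_rabs_zero[OF w], of 12]
        tendsto_mult_left[OF tendsto_rabs_zero[OF u], of 9]] by simp
  have "(\<lambda>n. sin (3 * v n $ 1)) \<longlonglongrightarrow> 0"
    using b1 by (intro Lim_null_comparison[OF always_eventually l1]) simp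
  moreover have "(\<lambda>n. sin (3 * v n $ 2)) \<longlonglongrightarrow> 0"
    using b2 by (intro Lim_null_comparison[OF always_eventually l2]) simp
  moreover have "(\<lambda>n. 3 * v (Suc n) $ i - 3 * v n $ i) \<longlonglongrightarrow> 0" for i
    using tendsto_mult_left[OF tendsto_vec_nth[OF step, of i], of 3] by (simp add: algebra_simps)
  ultimately have c: "convergent (\<lambda>n. 3 * v n $ 1)" "convergent (\<lambda>n. 3 * v n $ 2)"
    by (simp_all only: convergent_of_sin_tendsto_0)
  have "convergent (\<lambda>n. v n $ i)" for i
    using c exhaust_2[of i] convergent_mult_const_iff[of 3 "\<lambda>n. v n $ i"] by auto
  then obtain l where "(\<lambda>n. v n $ i) \<longlonglongrightarrow> l i" for i unfolding convergent_def by metis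
  then have "v \<longlonglongrightarrow> (\<chi> i. l i)" by (intro vec_tendstoI) simp
  then show ?thesis by (auto simp: convergent_def)
qed

section \<open>Bounds and continuity of the potential, the drift and the lift\<close>

lemma potential_bounds: "- 3 \<le> potential v" "potential v \<le> 3"
  using cos_ge_minus_one[of "v $ 1"] cos_ge_minus_one[of "v $ 2"] cos_ge_minus_one[of "v $ 1 - v $ 2"]
    cos_le_one[of "v $ 1"] cos_le_one[of "v $ 2"] cos_le_one[of "v $ 1 - v $ 2"]
  unfolding potential_def by linarith+

lemma continuous_on_drift [continuous_intros]:
  fixes f :: "real^2 \<Rightarrow> real^2"
  shows "continuous_on A f \<Longrightarrow> continuous_on A (\<lambda>x. drift (f x))"
  unfolding drift_def vector2_eq_axis by (intro continuous_intros)

lemma continuous_on_potential [continuous_intros]: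
  fixes f :: "real^2 \<Rightarrow> real^2"
  shows "continuous_on A f \<Longrightarrow> continuous_on A (\<lambda>x. potential (f x))"
  unfolding potential_def by (intro continuous_intros)

lemma continuous_on_G_lift [continuous_intros]:
  fixes f :: "real^2 \<Rightarrow> real^2"
  shows "continuous_on A f \<Longrightarrow> continuous_on A (\<lambda>x. G_lift a (f x))"
  unfolding G_lift_eq by (intro continuous_intros)

lemma norm_drift_le: "norm (drift v) \<le> 8"
proof -
  have b: "\<bar>sin t\<bar> \<le> 1" for t :: real by simp
  have "\<bar>drift v $ 1\<bar> \<le> 4" "\<bar>drift v $ 2\<bar> \<le> 4"
    using b[of "v $ 1"] b[of "v $ 2"] b[of "v $ 1 - v $ 2"]
    unfolding drift_def vector_2 by linarith+
  moreover have "norm (drift v) \<le> \<bar>drift v $ 1\<bar> + \<bar>drift v $ 2\<bar>"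
    using norm_le_l1_cart[of "drift v"] by (simp add: sum_2)
  ultimately show ?thesis by linarith
qed

lemma hex_form_nonneg: "0 \<le> hex_form v"
  by (simp add: hex_form_def)

lemma hex_form_eq_0_iff: "hex_form v = 0 \<longleftrightarrow> v = 0"
  using norm_sq_le_hex_form[of v] by (auto simp: hex_form_def)

section \<open>The Jacobian matrix of the lift\<close>

definition G_jac :: "real \<Rightarrow> real^2 \<Rightarrow> real^2^2" where
  "G_jac a v = (let c = cos (v $ 1); d = cos (v $ 2); e = cos (v $ 1 - v $ 2) in
     vector [vector [1 + a * (2 * c + e), a * (d - e)],
             vector [a * (c - e), 1 + a * (2 * d + e)]])"

lemma G_jac_mult: "G_jac a v *v h = vector
    [h $ 1 + a * (2 * (cos (v $ 1) * h $ 1) + cos (v $ 2) * h $ 2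
       + cos (v $ 1 - v $ 2) * (h $ 1 - h $ 2)),
     h $ 2 + a * (cos (v $ 1) * h $ 1 + 2 * (cos (v $ 2) * h $ 2)
       - cos (v $ 1 - v $ 2) * (h $ 1 - h $ 2))]"
  by (simp add: G_jac_def Let_def vec_eq_iff forall_2 matrix_vector_mult_def sum_2 algebra_simps)

lemma has_derivative_G_lift: "(G_lift a has_derivative (\<lambda>h. G_jac a v *v h)) (at v)"
proof -
  \<comment> \<open>Scaled axis vectors put the map into a form that the derivative rules
    decompose.\<close>
  have *: "G_lift a = (\<lambda>v. (v $ 1 + a * (2 * sin (v $ 1) + sin (v $ 2) + sin (v $ 1 - v $ 2))) *\<^sub>R axis 1 1
      + (v $ 2 + a * (sin (v $ 1) + 2 * sin (v $ 2) - sin (v $ 1 - v $ 2))) *\<^sub>R axis 2 1)"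
    by (simp add: fun_eq_iff G_lift_eq drift_def vec_eq_iff forall_2 axis_def)
  have nth: "((\<lambda>v::real^2. v $ i) has_derivative (\<lambda>h. h $ i)) (at v)" for i
    by (rule bounded_linear.has_derivative[OF bounded_linear_vec_nth has_derivative_ident])
  show ?thesis
    unfolding * G_jac_mult vector2_eq_axis
    by (auto intro!: derivative_eq_intros nth ext simp: algebra_simps)
qed

text \<open>The set \<open>T\<close> will be the whole plane at sinks and sources, and an invariant
  line at saddles. On \<open>T\<close> near \<open>p\<close> the map contracts; the ball is centred
  at \<open>x\<close>, which may be far from \<open>p\<close>, because stable tangent vectors are
  needed along the whole stable manifold.\<close>

lemma uniform_attraction:
  fixes f :: "'a::real_normed_vector \<Rightarrow> 'a"
  assumes der: "(f has_derivative L) (at p)" and fix_p: "f p = p"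
    and contr: "\<And>y. y \<in> T \<Longrightarrow> L (y - p) = c *\<^sub>R (y - p)" and c: "\<bar>c\<bar> < 1"
    and inv: "\<And>y. y \<in> T \<Longrightarrow> f y \<in> T" and cont: "continuous_on UNIV f"
    and x: "x \<in> T" "(\<lambda>n. (f ^^ n) x) \<longlonglongrightarrow> p"
  obtains d where "d > 0"
    and "\<And>U. open U \<Longrightarrow> p \<in> U \<Longrightarrow> \<forall>\<^sub>F n in sequentially. \<forall>y\<in>T \<inter> ball x d. (f ^^ n) y \<in> U"
proof -
  \<comment> \<open>A contraction rate strictly between the modulus of \<open>c\<close> and 1; the
    difference is the room left for the linearization error.\<close>
  define k where "k = (1 + \<bar>c\<bar>) / 2"
  have k: "0 < k" "k < 1" "0 < k - \<bar>c\<bar>" using c by (auto simp: k_def)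
  from der[unfolded has_derivative_at_alt] k(3) obtain r where r: "r > 0"
    and rL: "\<And>y. norm (y - p) < r \<Longrightarrow> norm (f y - f p - L (y - p)) \<le> (k - \<bar>c\<bar>) * norm (y - p)"
    by blast
  have step: "norm (f y - p) \<le> k * norm (y - p)" if "y \<in> T" "norm (y - p) < r" for y
  proof -
    have "norm (f y - p) \<le> norm (f y - f p - L (y - p)) + norm (L (y - p))"
      using norm_triangle_sub[of "f y - p" "L (y - p)"] by (simp add: fix_p)
    also have "\<dots> \<le> (k - \<bar>c\<bar>) * norm (y - p) + \<bar>c\<bar> * norm (y - p)"
      using rL[OF that(2)] contr[OF that(1)] by simp
    finally show ?thesis by (simp add: algebra_simps)
  qed
  have iter: "(f ^^ n) y \<in> T \<and> norm ((f ^^ n) y - p) \<le> k ^ n * r"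
    if "y \<in> T" "norm (y - p) < r" for y n
  proof -
    have "(f ^^ n) y \<in> T \<and> norm ((f ^^ n) y - p) \<le> k ^ n * norm (y - p)"
    proof (induction n)
      case (Suc n)
      have "k ^ n * norm (y - p) \<le> 1 * norm (y - p)"
        using k by (intro mult_right_mono power_le_one) auto
      then have "norm ((f ^^ n) y - p) < r" using Suc that by linarith
      then have "norm ((f ^^ Suc n) y - p) \<le> k * norm ((f ^^ n) y - p)"
        using step Suc by simp
      also have "\<dots> \<le> k * (k ^ n * norm (y - p))" using Suc k by (intro mult_left_mono) auto
      finally show ?case using inv Suc by (simp add: mult.assoc)
    qed (use that in simp)
    moreover have "k ^ n * norm (y - p) \<le> k ^ n * r" using that k by (intro mult_left_mono) auto
    ultimately show ?thesis by linarith
  qed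
  have in_T: "(f ^^ n) y \<in> T" if "y \<in> T" for y n
    by (induction n) (use that inv in auto)
  \<comment> \<open>Finitely many iterates bring \<open>x\<close> into the region of contraction,
    and by continuity they bring a ball around \<open>x\<close> there too.\<close>
  from x(2) r obtain N where N: "norm ((f ^^ N) x - p) < r"
    unfolding LIMSEQ_iff by blast
  have "continuous_on UNIV (f ^^ N)"
    by (induction N) (auto intro!: continuous_on_compose2[OF cont])
  then have "open ((f ^^ N) -` ball p r)" by (intro open_vimage) auto
  moreover have "x \<in> (f ^^ N) -` ball p r" using N by (simp add: dist_norm norm_minus_commute)
  ultimately obtain d where d: "d > 0" "ball x d \<subseteq> (f ^^ N) -` ball p r"
    unfolding open_contains_ball by blast
  show thesis
  proof (rule that[OF d(1)])
    fix U assume "open U" "p \<in> U"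
    then obtain e where e: "e > 0" "ball p e \<subseteq> U" unfolding open_contains_ball by blast
    have "(\<lambda>n. k ^ n * r) \<longlonglongrightarrow> 0 * r"
      using k by (intro tendsto_intros LIMSEQ_realpow_zero) auto
    then have "\<forall>\<^sub>F n in sequentially. k ^ n * r < e"
      using e(1) by (intro order_tendstoD(2)) auto
    then have "\<forall>\<^sub>F n in sequentially. \<forall>y\<in>T \<inter> ball x d. (f ^^ (n + N)) y \<in> U"
    proof eventually_elim
      case (elim n)
      show ?case
      proof
        fix y assume y: "y \<in> T \<inter> ball x d"
        then have "norm ((f ^^ N) y - p) < r" using d(2) by (auto simp: dist_norm norm_minus_commute)
        then have "norm ((f ^^ n) ((f ^^ N) y) - p) \<le> k ^ n * r" using iter in_T y by blast
        with elim have "norm ((f ^^ n) ((f ^^ N) y) - p) < e" by simp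
        then show "(f ^^ (n + N)) y \<in> U"
          using e(2) by (auto simp: funpow_add dist_norm norm_minus_commute)
      qed
    qed
    then show "\<forall>\<^sub>F n in sequentially. \<forall>y\<in>T \<inter> ball x d. (f ^^ n) y \<in> U"
      by (rule eventually_sequentially_seg[THEN iffD1])
  qed
qed

text \<open>The adjugate. An inverse written as adjugate over determinant visibly depends
  continuously on the matrix.\<close>

definition adj2 :: "real^2^2 \<Rightarrow> real^2^2" where
  "adj2 M = vector [vector [M $ 2 $ 2, - M $ 1 $ 2], vector [- M $ 2 $ 1, M $ 1 $ 1]]"

lemma adj2_nth [simp]:
  "adj2 M $ 1 $ 1 = M $ 2 $ 2" "adj2 M $ 1 $ 2 = - M $ 1 $ 2"
  "adj2 M $ 2 $ 1 = - M $ 2 $ 1" "adj2 M $ 2 $ 2 = M $ 1 $ 1"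
  by (simp_all add: adj2_def)

lemma adj2_mult:
  assumes "det M \<noteq> 0"
  shows "((1 / det M) *\<^sub>R adj2 M) *v (M *v h) = h"
proof -
  have "adj2 M *v (M *v h) = det M *\<^sub>R h"
    by (simp add: adj2_def det_2 vec_eq_iff forall_2 matrix_vector_mult_def sum_2 algebra_simps)
  then show ?thesis using assms by (simp add: scaleR_matrix_vector_assoc[symmetric])
qed

section \<open>The lift is a diffeomorphism of the plane\<close>

locale small_step =
  fixes a :: real
  assumes a_pos: "0 < a" and a_less: "a < 1 / 3"
begin

lemma hex_form_G_lift_diff_ge:
  "(1 - 3 * a)\<^sup>2 * hex_form (v - w) \<le> hex_form (G_lift a v - G_lift a w)"
proof -
  have "G_lift a v - G_lift a w = (v - w) + a *\<^sub>R (drift v - drift w)"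
    by (simp add: G_lift_eq algebra_simps)
  then show ?thesis
    using hex_form_expansion_ge[OF hex_form_drift_diff_le] a_pos a_less by simp
qed

lemma inj_G_lift: "inj (G_lift a)"
proof (rule injI)
  fix v w assume "G_lift a v = G_lift a w"
  then have "(1 - 3 * a)\<^sup>2 * hex_form (v - w) \<le> 0"
    using hex_form_G_lift_diff_ge[of v w] by (simp add: hex_form_def)
  then have "hex_form (v - w) \<le> 0" using a_less by (simp add: mult_le_0_iff)
  then show "v = w" using hex_form_nonneg[of "v - w"] hex_form_eq_0_iff[of "v - w"] by simp
qed

lemma surj_G_lift: "surj (G_lift a)"
proof (rule surjI)
  fix y
  \<comment> \<open>A preimage of \<open>y\<close> is a fixed point of this map, which sends the
    ball into itself since the drift has norm at most 8 and \<open>a < 1\<close>.\<close>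
  have "\<exists>v\<in>cball y 8. y - a *\<^sub>R drift v = v"
  proof (rule brouwer)
    have "a * norm (drift v) \<le> 1 * 8" for v
      using a_pos a_less norm_drift_le by (intro mult_mono) auto
    then show "(\<lambda>v. y - a *\<^sub>R drift v) \<in> cball y 8 \<rightarrow> cball y 8"
      using a_pos by (auto simp: dist_norm)
  qed (auto intro!: continuous_intros)
  then obtain v where "G_lift a v = y" by (auto simp: G_lift_eq algebra_simps)
  then show "G_lift a (inv (G_lift a) y) = y" by (metis f_inv_into_f rangeI)
qed

definition H_lift :: "real^2 \<Rightarrow> real^2" where
  "H_lift = inv (G_lift a)"

lemma G_H_lift [simp]: "G_lift a (H_lift v) = v"
  by (simp add: H_lift_def surj_f_inv_f[OF surj_G_lift])

lemma H_G_lift [simp]: "H_lift (G_lift a v) = v"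
  by (simp add: H_lift_def inv_f_f[OF inj_G_lift])

lemma norm_H_lift_diff_le: "(1 - 3 * a) * norm (H_lift v - H_lift w) \<le> 2 * norm (v - w)"
proof (rule power2_le_imp_le)
  have "((1 - 3 * a) * norm (H_lift v - H_lift w))\<^sup>2 \<le> (1 - 3 * a)\<^sup>2 * hex_form (H_lift v - H_lift w)"
    unfolding power_mult_distrib by (intro mult_left_mono norm_sq_le_hex_form) simp
  also have "\<dots> \<le> hex_form (v - w)" using hex_form_G_lift_diff_ge[of "H_lift v" "H_lift w"] by simp
  also have "\<dots> \<le> (2 * norm (v - w))\<^sup>2"
    by (rule order_trans[OF hex_form_le_norm_sq]) (simp add: power_mult_distrib)
  finally show "((1 - 3 * a) * norm (H_lift v - H_lift w))\<^sup>2 \<le> (2 * norm (v - w))\<^sup>2" .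
qed simp

lemma continuous_on_H_lift: "continuous_on UNIV H_lift"
proof -
  have "(2 / (1 - 3 * a))-lipschitz_on UNIV H_lift"
    using norm_H_lift_diff_le a_less
    by (intro lipschitz_onI) (auto simp: dist_norm field_simps)
  then show ?thesis by (rule lipschitz_on_continuous_on)
qed

text \<open>This is the infinitesimal form of the injectivity argument: multiplication by cosines
  replaces sine increments, and the same expansion estimate makes the kernel trivial.\<close>

lemma det_G_jac_nz: "det (G_jac a v) \<noteq> 0"
proof -
  have "h = 0" if h: "G_jac a v *v h = 0" for h
  proof -
    let ?p = "cos (v $ 1) * h $ 1" and ?q = "cos (v $ 2) * h $ 2"
    let ?r = "cos (v $ 1 - v $ 2) * (h $ 1 - h $ 2)"
    let ?e = "vector [2 * ?p + ?q + ?r, ?p + 2 * ?q - ?r] :: real^2"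
    have cos_sq: "(cos t * s)\<^sup>2 \<le> s\<^sup>2" for t s :: real
      unfolding power_mult_distrib by (rule mult_left_le_one_le) (simp_all add: abs_square_le_1)
    have "hex_form ?e \<le> 9 * hex_form h" by (intro hex_form_combination_le cos_sq)
    then have "(1 - 3 * a)\<^sup>2 * hex_form h \<le> hex_form (h + a *\<^sub>R ?e)"
      using a_pos a_less by (intro hex_form_expansion_ge) auto
    moreover have "h + a *\<^sub>R ?e = G_jac a v *v h"
      unfolding G_jac_mult by (simp add: vec_eq_iff forall_2)
    ultimately have "(1 - 3 * a)\<^sup>2 * hex_form h \<le> 0"
      unfolding h by (simp add: hex_form_def)
    then have "hex_form h \<le> 0" using a_less by (simp add: mult_le_0_iff)
    then show "h = 0" using hex_form_nonneg[of h] hex_form_eq_0_iff[of h] by simp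
  qed
  then have "invertible (G_jac a v)"
    unfolding invertible_left_inverse matrix_left_invertible_ker by blast
  then show ?thesis by (simp add: invertible_det_nz)
qed

definition H_jac :: "real^2 \<Rightarrow> real^2^2" where
  "H_jac w = (1 / det (G_jac a (H_lift w))) *\<^sub>R adj2 (G_jac a (H_lift w))"

lemma H_jac_mult: "H_jac w *v (G_jac a (H_lift w) *v h) = h"
  unfolding H_jac_def by (rule adj2_mult[OF det_G_jac_nz])

lemma has_derivative_H_lift: "(H_lift has_derivative (\<lambda>h. H_jac w *v h)) (at w)"
proof (rule has_derivative_inverse_basic[OF has_derivative_G_lift])
  show "(\<lambda>h. H_jac w *v h) \<circ> (\<lambda>h. G_jac a (H_lift w) *v h) = id"
    by (simp add: fun_eq_iff H_jac_mult)
  show "continuous (at w) H_lift"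
    using continuous_on_H_lift by (simp add: continuous_on_eq_continuous_at)
qed (rule matrix_vector_mul_bounded_linear open_UNIV UNIV_I G_H_lift)+

section \<open>Monotonicity of the potential and convergence of orbits\<close>

lemma potential_less_G_lift:
  "drift v \<noteq> 0 \<Longrightarrow> potential v < potential (G_lift a v)"
  and potential_le_G_lift: "potential v \<le> potential (G_lift a v)"
proof -
  have k: "0 < a / 3 - a\<^sup>2 / 2"
    using a_pos a_less by (simp add: power2_eq_square field_simps)
  show "potential v \<le> potential (G_lift a v)"
    using potential_G_lift_ge[of v a] mult_nonneg_nonneg[OF less_imp_le[OF k] hex_form_nonneg[of "drift v"]]
    by linarith
  assume "drift v \<noteq> 0"
  then have "0 < hex_form (drift v)"
    using hex_form_nonneg[of "drift v"] hex_form_eq_0_iff[of "drift v"] by linarith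
  then have "0 < (a / 3 - a\<^sup>2 / 2) * hex_form (drift v)" using k by simp
  then show "potential v < potential (G_lift a v)"
    using potential_G_lift_ge[of v a] by linarith
qed

text \<open>The increments of a convergent potential tend to 0 and dominate the squared norm of the
  drift. The second sequence \<open>w\<close> covers both directions of time: it is \<open>v\<close>
  itself for forward orbits, and \<open>v\<close> shifted by one for backward orbits.\<close>

lemma drift_tendsto_0:
  assumes "\<And>n. \<bar>potential (v (Suc n)) - potential (v n)\<bar> = potential (G_lift a (w n)) - potential (w n)"
    and "convergent (\<lambda>n. potential (v n))"
  shows "(\<lambda>n. drift (w n)) \<longlonglongrightarrow> 0"
proof -
  define k where "k = a / 3 - a\<^sup>2 / 2"
  have k: "0 < k"
    using a_pos a_less by (simp add: k_def power2_eq_square field_simps)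
  from assms(2) obtain l where l: "(\<lambda>n. potential (v n)) \<longlonglongrightarrow> l" by (auto simp: convergent_def)
  have "(\<lambda>n. potential (v (Suc n)) - potential (v n)) \<longlonglongrightarrow> l - l"
    by (intro tendsto_intros l LIMSEQ_Suc)
  then have "(\<lambda>n. \<bar>potential (v (Suc n)) - potential (v n)\<bar>) \<longlonglongrightarrow> 0"
    by (simp add: tendsto_rabs_zero)
  from tendsto_mult_left[OF this, of "1 / k"]
  have lim: "(\<lambda>n. 1 / k * \<bar>potential (v (Suc n)) - potential (v n)\<bar>) \<longlonglongrightarrow> 0" by simp
  have "(norm (drift (w n)))\<^sup>2 \<le> 1 / k * \<bar>potential (v (Suc n)) - potential (v n)\<bar>" for n
  proof -
    have "k * (norm (drift (w n)))\<^sup>2 \<le> k * hex_form (drift (w n))"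
      using k norm_sq_le_hex_form by (intro mult_left_mono) auto
    also have "\<dots> \<le> \<bar>potential (v (Suc n)) - potential (v n)\<bar>"
      using potential_G_lift_ge[of "w n" a] unfolding assms(1) k_def by linarith
    finally show ?thesis using k by (simp add: field_simps)
  qed
  then have "(\<lambda>n. (norm (drift (w n)))\<^sup>2) \<longlonglongrightarrow> 0"
    by (intro Lim_null_comparison[OF always_eventually lim]) simp
  then have "(\<lambda>n. norm (drift (w n))) \<longlonglongrightarrow> 0" by (simp add: tendsto_null_power)
  then show ?thesis by (rule tendsto_norm_zero_cancel)
qed

lemma G_orbit_converges: "\<exists>l. drift l = 0 \<and> (\<lambda>n. (G_lift a ^^ n) v) \<longlonglongrightarrow> l"
proof -
  let ?v = "\<lambda>n. (G_lift a ^^ n) v"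
  have "incseq (\<lambda>n. potential (?v n))" by (intro incseq_SucI) (simp add: potential_le_G_lift)
  then have "convergent (\<lambda>n. potential (?v n))"
    using potential_bounds(2) by (auto simp: convergent_def elim!: incseq_convergent[of _ 3])
  then have d: "(\<lambda>n. drift (?v n)) \<longlonglongrightarrow> 0"
    using potential_le_G_lift by (intro drift_tendsto_0) auto
  have "(\<lambda>n. ?v (Suc n) - ?v n) \<longlonglongrightarrow> 0"
    using tendsto_scaleR[OF tendsto_const[of a] d] by (simp add: G_lift_eq)
  from convergent_of_drift_tendsto_0[OF d this] obtain l where l: "?v \<longlonglongrightarrow> l"
    by (auto simp: convergent_def)
  have "(\<lambda>n. drift (?v n)) \<longlonglongrightarrow> drift l"
    by (rule continuous_on_tendsto_compose[OF continuous_on_drift[OF continuous_on_id[of UNIV]] l]) auto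
  then show ?thesis using l d LIMSEQ_unique by blast
qed

lemma H_orbit_converges: "\<exists>l. drift l = 0 \<and> (\<lambda>n. (H_lift ^^ n) v) \<longlonglongrightarrow> l"
proof -
  let ?v = "\<lambda>n. (H_lift ^^ n) v"
  have le: "potential (H_lift w) \<le> potential w" for w
    using potential_le_G_lift[of "H_lift w"] by simp
  have "decseq (\<lambda>n. potential (?v n))" by (intro decseq_SucI) (simp add: le)
  then have "convergent (\<lambda>n. potential (?v n))"
    using potential_bounds(1) by (auto simp: convergent_def elim!: decseq_convergent[of _ "-3"])
  then have dS: "(\<lambda>n. drift (?v (Suc n))) \<longlonglongrightarrow> 0"
    using le by (intro drift_tendsto_0) auto
  then have d: "(\<lambda>n. drift (?v n)) \<longlonglongrightarrow> 0" by (rule LIMSEQ_imp_Suc)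
  \<comment> \<open>A backward step is governed by the drift at its end point, hence the shifted
    index.\<close>
  have "?v (Suc n) - ?v n = - (a *\<^sub>R drift (?v (Suc n)))" for n
    using G_lift_eq[of a "?v (Suc n)"] by (simp add: algebra_simps)
  then have "(\<lambda>n. ?v (Suc n) - ?v n) \<longlonglongrightarrow> 0"
    using tendsto_minus[OF tendsto_scaleR[OF tendsto_const[of a] dS]] by simp
  from convergent_of_drift_tendsto_0[OF d this] obtain l where l: "?v \<longlonglongrightarrow> l"
    by (auto simp: convergent_def)
  have "(\<lambda>n. drift (?v n)) \<longlonglongrightarrow> drift l"
    by (rule continuous_on_tendsto_compose[OF continuous_on_drift[OF continuous_on_id[of UNIV]] l]) auto
  then show ?thesis using l d LIMSEQ_unique by blast
qed

end

section \<open>Lifts of maps of the torus\<close>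

lemma torus_cases [case_names proj]: obtains v where "p = torus_proj v"
  by (metis torus_proj.abs_eq Quotient_abs_rep[OF Quotient_torus])

lemma torus_proj_eq_iff: "torus_proj v = torus_proj w \<longleftrightarrow> lattice_equiv v w"
  by transfer simp

lemma open_torus_iff: "open U \<longleftrightarrow> open (torus_proj -` U)"
  by (simp add: open_torus_def)

lemma continuous_on_torus_iff: "continuous_on UNIV f \<longleftrightarrow> continuous_on UNIV (\<lambda>v. f (torus_proj v))"
  by (simp add: continuous_on_open_vimage open_torus_iff vimage_def)

lemma continuous_on_torus_proj [continuous_intros]:
  "continuous_on A f \<Longrightarrow> continuous_on A (\<lambda>x. torus_proj (f x))"
  using continuous_on_compose2[of UNIV torus_proj A f] continuous_on_torus_iff[of id]
  by (simp add: continuous_on_id id_def)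

lemma tendsto_torus_proj:
  assumes "(X \<longlongrightarrow> l) F" shows "((\<lambda>n. torus_proj (X n)) \<longlongrightarrow> torus_proj l) F"
  using continuous_on_tendsto_compose[OF continuous_on_torus_proj[OF continuous_on_id[of UNIV]] assms]
  by simp

lemma lattice_equiv_iff_sin_cos:
  "lattice_equiv v w \<longleftrightarrow> (\<forall>i. sin (v $ i) = sin (w $ i) \<and> cos (v $ i) = cos (w $ i))"
  unfolding lattice_equiv_def sin_cos_eq_iff by (simp add: mult_ac)

lemma lattice_equiv_sin_cos:
  assumes "lattice_equiv v w"
  shows "sin (v $ i) = sin (w $ i)" "cos (v $ i) = cos (w $ i)"
    "sin (v $ i - v $ j) = sin (w $ i - w $ j)" "cos (v $ i - v $ j) = cos (w $ i - w $ j)"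
  using assms by (auto simp: lattice_equiv_iff_sin_cos sin_diff cos_diff)

lemma lattice_equiv_iff_diff: "lattice_equiv v w \<longleftrightarrow> lattice_equiv (v - w) 0"
  by (simp add: lattice_equiv_def algebra_simps)

lemma drift_cong: "lattice_equiv v w \<Longrightarrow> drift v = drift w"
  by (simp add: drift_def lattice_equiv_sin_cos)

lemma potential_cong: "lattice_equiv v w \<Longrightarrow> potential v = potential w"
  by (simp add: potential_def lattice_equiv_sin_cos)

lemma G_jac_cong: "lattice_equiv v w \<Longrightarrow> G_jac a v = G_jac a w"
  by (simp add: G_jac_def lattice_equiv_sin_cos)

text \<open>A continuous injection of the torus into a Euclidean space, from which the torus
  inherits the Hausdorff property.\<close>

lift_definition circle_coords :: "torus \<Rightarrow> (real^2) \<times> (real^2)" is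
  "\<lambda>v. (\<chi> i. sin (v $ i), \<chi> i. cos (v $ i))"
  by (simp add: lattice_equiv_iff_sin_cos)

lemma circle_coords_proj: "circle_coords (torus_proj v) = (\<chi> i. sin (v $ i), \<chi> i. cos (v $ i))"
  by transfer simp

lemma inj_circle_coords: "circle_coords p = circle_coords q \<Longrightarrow> p = q"
  by transfer (simp add: lattice_equiv_iff_sin_cos vec_eq_iff)

lemma continuous_on_circle_coords: "continuous_on UNIV circle_coords"
  unfolding continuous_on_torus_iff circle_coords_proj
  by (intro continuous_intros)

instance torus :: t2_space
proof
  fix p q :: torus assume "p \<noteq> q"
  then have "circle_coords p \<noteq> circle_coords q" using inj_circle_coords by blast
  from hausdorff[OF this] obtain U V
    where UV: "open U" "open V" "circle_coords p \<in> U" "circle_coords q \<in> V" "U \<inter> V = {}"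
    by blast
  have "open (circle_coords -` U)" "open (circle_coords -` V)"
    using UV continuous_on_circle_coords by (auto intro: open_vimage)
  then show "\<exists>U V. open U \<and> open V \<and> p \<in> U \<and> q \<in> V \<and> U \<inter> V = {}"
    using UV by (intro exI[of _ "circle_coords -` U"] exI[of _ "circle_coords -` V"]) auto
qed

section \<open>Limit sets of convergent orbits, and notions at fixed points\<close>

lemma omega_limit_set_of_tendsto:
  fixes x p :: "'a::t2_space"
  assumes lim: "(\<lambda>n. (f ^^ n) x) \<longlonglongrightarrow> p"
  shows "omega_limit_set f x = {p}"
proof (intro equalityI subsetI)
  fix q assume q: "q \<in> omega_limit_set f x"
  show "q \<in> {p}"
  proof (rule ccontr)
    assume "q \<notin> {p}"
    then obtain U V where UV: "open U" "open V" "p \<in> U" "q \<in> V" "U \<inter> V = {}"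
      using hausdorff[of p q] by auto
    from topological_tendstoD[OF lim UV(1,3)] obtain N where "\<And>n. n \<ge> N \<Longrightarrow> (f ^^ n) x \<in> U"
      by (auto simp: eventually_sequentially)
    then have "{(f ^^ n) x | n. n \<ge> N} \<inter> V = {}" using UV(5) by blast
    then have "q \<notin> closure {(f ^^ n) x | n. n \<ge> N}"
      using open_Int_closure_eq_empty[OF UV(2)] UV(4) by (simp add: Int_commute) blast
    then show False using q by (auto simp: omega_limit_set_def)
  qed
next
  fix q assume "q \<in> {p}"
  have "p \<in> closure {(f ^^ n) x | n. n \<ge> N}" for N
  proof (rule closure_iff_nhds_not_empty[THEN iffD2], intro allI impI)
    fix A V assume V: "V \<subseteq> A" "open V" "p \<in> V"
    from topological_tendstoD[OF lim V(2,3)] obtain M where "\<And>n. n \<ge> M \<Longrightarrow> (f ^^ n) x \<in> V"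
      by (auto simp: eventually_sequentially)
    then have "(f ^^ max M N) x \<in> V" by simp
    then have "(f ^^ max M N) x \<in> {(f ^^ n) x | n. n \<ge> N} \<inter> A" using V(1) max.cobounded2 by blast
    then show "{(f ^^ n) x | n. n \<ge> N} \<inter> A \<noteq> {}" by blast
  qed
  then show "q \<in> omega_limit_set f x" using \<open>q \<in> {p}\<close> by (auto simp: omega_limit_set_def)
qed

lemma funpow_fixed_point: "f p = p \<Longrightarrow> (f ^^ n) p = p"
  by (induction n) simp_all

lemma period_fixed_point: "f p = p \<Longrightarrow> period f p = 1"
  unfolding period_def by (rule Least_equality) auto

lemma forward_orbit_fixed_point: "f p = p \<Longrightarrow> forward_orbit f p = {p}"
  by (auto simp: forward_orbit_def funpow_fixed_point)

lemma stable_manifold_fixed_point: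
  "f p = p \<Longrightarrow> stable_manifold f p = {x. (\<lambda>n. (f ^^ n) x) \<longlonglongrightarrow> p}"
  by (simp add: stable_manifold_def period_fixed_point)

section \<open>Derivatives of torus maps computed through a lift\<close>

lemma lattice_equiv_0_discrete:
  assumes "lattice_equiv v 0" and "norm v < pi" shows "v = 0"
proof -
  have "v $ i = 0" for i
  proof -
    obtain k :: int where k: "v $ i = 2 * pi * of_int k" using assms(1) by (auto simp: lattice_equiv_def)
    have "\<bar>v $ i\<bar> < pi" using component_le_norm_cart[of v i] assms(2) by linarith
    then have "2 * pi * \<bar>real_of_int k\<bar> < pi" by (simp add: k abs_mult)
    then have "pi * (2 * \<bar>real_of_int k\<bar>) < pi * 1" by simp
    then have "2 * \<bar>real_of_int k\<bar> < 1" by (simp only: mult_less_cancel_left_pos[OF pi_gt_zero])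
    then have "k = 0" by linarith
    then show ?thesis using k by simp
  qed
  then show ?thesis by (simp add: vec_eq_iff)
qed

text \<open>Two lifts that are continuous at \<open>v\<close> differ near \<open>v\<close> by a constant lattice vector, because
  lattice vectors form a discrete set.\<close>

lemma has_lifted_derivative_unique:
  fixes g :: "real^2 \<Rightarrow> real^2"
  assumes "has_lifted_derivative (\<lambda>w. torus_proj (g w)) L v" and g: "(g has_derivative M) (at v)"
  shows "L = M"
proof -
  from assms(1) obtain H where H: "\<forall>\<^sub>F w in nhds v. torus_proj (H w) = torus_proj (g w)"
    and dH: "(H has_derivative L) (at v)" by (auto simp: has_lifted_derivative_def)
  define E where "E w = H w - g w" for w
  have dE: "(E has_derivative (\<lambda>h. L h - M h)) (at v)"
    unfolding E_def by (intro derivative_intros dH g)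
  have latt: "\<forall>\<^sub>F w in nhds v. lattice_equiv (E w) 0"
    using H by (simp add: torus_proj_eq_iff E_def flip: lattice_equiv_iff_diff)
  then have Ev: "lattice_equiv (E v) 0" by (rule eventually_nhds_x_imp_x)
  have "E \<midarrow>v\<rightarrow> E v" using has_derivative_continuous[OF dE] by (simp add: isCont_def)
  then have "\<forall>\<^sub>F w in at v. dist (E w) (E v) < pi" by (rule tendstoD) simp
  then have "\<forall>\<^sub>F w in nhds v. dist (E w) (E v) < pi" by (simp add: eventually_nhds_conv_at)
  with latt have "\<forall>\<^sub>F w in nhds v. E w = E v"
  proof eventually_elim
    case (elim w)
    have "lattice_equiv (E w) (E v)"
      using elim(1) Ev equivp_lattice_equiv by (meson equivp_symp equivp_transp)
    then have "E w - E v = 0"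
      using elim(2) by (intro lattice_equiv_0_discrete) (simp_all add: dist_norm flip: lattice_equiv_iff_diff)
    then show ?case by simp
  qed
  then have "((\<lambda>w. E v) has_derivative (\<lambda>h. L h - M h)) (at v)"
    by (intro has_derivative_transform_eventually[OF dE]) (simp_all add: eventually_nhds_conv_at)
  then have "(\<lambda>h. L h - M h) = (\<lambda>h. 0)" by (rule has_derivative_unique) simp
  then show ?thesis by (auto simp: fun_eq_iff)
qed

lemma has_lifted_derivative_proj:
  "(g has_derivative M) (at v) \<Longrightarrow> has_lifted_derivative (\<lambda>w. torus_proj (g w)) M v"
  unfolding has_lifted_derivative_def by (intro exI[of _ g]) simp

lemma torus_C1I:
  assumes lift: "\<And>v. f (torus_proj v) = torus_proj (g v)"
    and der: "\<And>v. (g has_derivative (\<lambda>h. J v *v h)) (at v)"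
    and per: "\<And>v w. lattice_equiv v w \<Longrightarrow> J v = (J w :: real^2^2)"
    and cont: "continuous_on UNIV J"
  shows "torus_C1 f"
proof -
  \<comment> \<open>The choice of the representative is harmless because \<open>J\<close> is
    constant on lattice classes.\<close>
  define D where "D p = Blinfun (\<lambda>h. J (SOME v. torus_proj v = p) *v h)" for p
  have D: "blinfun_apply (D (torus_proj v)) = (\<lambda>h. J v *v h)" for v
  proof -
    have "torus_proj (SOME w. torus_proj w = torus_proj v) = torus_proj v"
      by (rule someI_ex) blast
    then have "J (SOME w. torus_proj w = torus_proj v) = J v"
      by (intro per) (simp add: torus_proj_eq_iff)
    then show ?thesis by (simp add: D_def bounded_linear_Blinfun_apply)
  qed
  have "continuous_on UNIV D"
    unfolding continuous_on_torus_iff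
    by (intro continuous_on_blinfun_componentwise)
       (simp add: D matrix_vector_mult_def, intro continuous_intros cont)
  moreover have "torus_has_derivative f (blinfun_apply (D p)) p" for p
    by (cases p rule: torus_cases)
       (auto simp: torus_has_derivative_def D lift intro!: has_lifted_derivative_proj der)
  ultimately show ?thesis by (auto simp: torus_C1_def)
qed

text \<open>The notions of hyperbolicity quantify over all derivatives at a point; this reduces them
  to the Jacobian of the lift.\<close>

lemma torus_has_derivative_unique:
  assumes lift: "\<And>v. f (torus_proj v) = torus_proj (g v)"
    and der: "\<And>v. (g has_derivative (\<lambda>h. J v *v h)) (at v)"
    and per: "\<And>v w. lattice_equiv v w \<Longrightarrow> J v = (J w :: real^2^2)"
  shows "torus_has_derivative f L (torus_proj v) \<longleftrightarrow> L = (\<lambda>h. J v *v h)"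
proof
  assume "torus_has_derivative f L (torus_proj v)"
  then obtain w where w: "lattice_equiv w v" "has_lifted_derivative (\<lambda>w. torus_proj (g w)) L w"
    by (auto simp: torus_has_derivative_def torus_proj_eq_iff lift)
  from has_lifted_derivative_unique[OF w(2) der] per[OF w(1)]
  show "L = (\<lambda>h. J v *v h)" by simp
next
  assume "L = (\<lambda>h. J v *v h)"
  then show "torus_has_derivative f L (torus_proj v)"
    by (auto simp: torus_has_derivative_def lift intro!: has_lifted_derivative_proj der)
qed

text \<open>Eigenvectors for \<open>c\<close> span the kernel of the matrix minus \<open>c\<close>
  times the identity, so \<open>c\<close> is an eigenvalue exactly when that determinant
  vanishes.\<close>

lemma complex_eigenvalues_matrix:
  "complex_eigenvalues (\<lambda>h. M *v h) =
    {c. (complex_of_real (M $ 1 $ 1) - c) * (of_real (M $ 2 $ 2) - c) = of_real (M $ 1 $ 2 * M $ 2 $ 1)}"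
proof -
  have "(\<exists>z::complex^2. z \<noteq> 0 \<and> map_matrix complex_of_real M *v z = c *s z) \<longleftrightarrow>
      (complex_of_real (M $ 1 $ 1) - c) * (of_real (M $ 2 $ 2) - c) = of_real (M $ 1 $ 2 * M $ 2 $ 1)" for c
  proof -
    define N :: "complex^2^2" where "N = map_matrix complex_of_real M - mat c"
    have N: "N *v z = map_matrix complex_of_real M *v z - c *s z" for z
      by (simp add: N_def matrix_vector_mult_diff_rdistrib vec_eq_iff matrix_vector_mult_def mat_def
          sum_2 forall_2 algebra_simps)
    have "(\<exists>z. z \<noteq> 0 \<and> N *v z = 0) \<longleftrightarrow> det N = 0"
      using invertible_det_nz[of N] unfolding invertible_left_inverse matrix_left_invertible_ker by blast
    moreover have "det N = 0 \<longleftrightarrow>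
      (complex_of_real (M $ 1 $ 1) - c) * (of_real (M $ 2 $ 2) - c) = of_real (M $ 1 $ 2 * M $ 2 $ 1)"
      by (simp add: N_def det_2 mat_def map_matrix_def)
    ultimately show ?thesis by (simp add: N)
  qed
  then show ?thesis by (simp add: complex_eigenvalues_def)
qed

text \<open>The required curve is the projection of a straight segment inside
  \<open>T\<close>.\<close>

lemma stable_tangent_spaceI:
  assumes lift: "\<And>v. f (torus_proj v) = torus_proj (g v)" and fix_p: "f (torus_proj l) = torus_proj l"
    and "d > 0" and T: "\<And>t. v + t *\<^sub>R u \<in> T"
    and unif: "\<And>U. open U \<Longrightarrow> l \<in> U \<Longrightarrow> \<forall>\<^sub>F n in sequentially. \<forall>y\<in>T \<inter> ball v d. (g ^^ n) y \<in> U"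
  shows "u \<in> stable_tangent_space f (torus_proj l) (torus_proj v)"
proof -
  have iter: "(f ^^ n) (torus_proj w) = torus_proj ((g ^^ n) w)" for n w
    by (induction n) (simp_all add: lift)
  \<comment> \<open>Parameters below \<open>e\<close> keep the segment inside the ball; the summand
    1 avoids division by 0 when \<open>u = 0\<close>.\<close>
  define e where "e = d / (1 + norm u)"
  have e: "e > 0" "e * norm u < d"
    using \<open>d > 0\<close> by (simp_all add: e_def add_pos_nonneg field_simps)
  define \<gamma> where "\<gamma> t = torus_proj (v + t *\<^sub>R u)" for t
  have "C1_curve_on e \<gamma> (\<lambda>_. u)"
    unfolding C1_curve_on_def has_lifted_derivative_def \<gamma>_def
    by (intro conjI ballI continuous_intros exI[of _ "\<lambda>t. v + t *\<^sub>R u"])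
       (auto intro!: derivative_eq_intros)
  moreover have "\<forall>\<^sub>F k in sequentially. \<forall>t\<in>{-e<..<e}. (f ^^ (k * period f (torus_proj l))) (\<gamma> t) \<in> U"
    if U: "open U" "torus_proj l \<in> U" for U
  proof -
    have "\<forall>\<^sub>F n in sequentially. \<forall>y\<in>T \<inter> ball v d. (g ^^ n) y \<in> torus_proj -` U"
      using U by (intro unif) (simp_all add: open_torus_iff)
    then show ?thesis
    proof eventually_elim
      case (elim n)
      have "v + t *\<^sub>R u \<in> ball v d" if "t \<in> {-e<..<e}" for t
      proof -
        have "\<bar>t\<bar> * norm u \<le> e * norm u" using that by (intro mult_right_mono) auto
        then show ?thesis using e(2) by (simp add: dist_norm)
      qed
      then show ?case using elim T by (simp add: period_fixed_point[of f, OF fix_p] \<gamma>_def iter)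
    qed
  qed
  ultimately show ?thesis
    unfolding stable_tangent_space_def mem_Collect_eq
    by (intro exI[of _ e] conjI exI[of _ \<gamma>] exI[of _ "\<lambda>_. u"]) (auto simp: e \<gamma>_def)
qed

text \<open>The constant curve at \<open>x\<close> serves as witness.\<close>

lemma zero_in_stable_tangent_space:
  assumes "f p = p" and x: "(\<lambda>n. (f ^^ n) x) \<longlonglongrightarrow> p"
  shows "0 \<in> stable_tangent_space f p x"
proof -
  obtain v where v: "x = torus_proj v" by (cases x rule: torus_cases)
  have "C1_curve_on 1 (\<lambda>_. x) (\<lambda>_. 0)"
    unfolding C1_curve_on_def has_lifted_derivative_def v
    by (intro conjI ballI continuous_intros exI[of _ "\<lambda>t. v"]) auto
  then show ?thesis
    unfolding stable_tangent_space_def mem_Collect_eq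
    by (intro exI[of _ 1] conjI exI[of _ "\<lambda>_. x"] exI[of _ "\<lambda>_. 0"])
       (auto simp: period_fixed_point[of f, OF assms(1)] elim!: topological_tendstoD[OF x])
qed

section \<open>The induced diffeomorphism of the torus\<close>

lemma G_map_torus_proj: "G_map a (torus_proj v) = torus_proj (G_lift a v)"
  by transfer (simp add: equivp_reflp[OF equivp_lattice_equiv])

section \<open>The zeros of the drift and their types\<close>

lemma cos_240: "cos (4 * pi / 3) = - 1 / 2" and sin_240: "sin (4 * pi / 3) = - (sqrt 3 / 2)"
proof -
  have *: "4 * pi / 3 = pi / 3 + pi" by simp
  show "cos (4 * pi / 3) = - 1 / 2" "sin (4 * pi / 3) = - (sqrt 3 / 2)"
    unfolding * cos_periodic_pi sin_periodic_pi cos_60 sin_60 by simp_all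
qed

lemma torus_proj_eq_torus_pt_iff:
  "torus_proj v = torus_pt x y \<longleftrightarrow>
    sin (v $ 1) = sin x \<and> cos (v $ 1) = cos x \<and> sin (v $ 2) = sin y \<and> cos (v $ 2) = cos y"
  by (auto simp: torus_proj_eq_iff lattice_equiv_iff_sin_cos forall_2)

definition critical_points :: "torus set" where
  "critical_points = {torus_pt 0 pi, torus_pt pi 0, torus_pt pi pi,
     torus_pt (2 * pi / 3) (4 * pi / 3), torus_pt (4 * pi / 3) (2 * pi / 3), torus_pt 0 0}"

lemma drift_eq_0_iff: "drift v = 0 \<longleftrightarrow> torus_proj v \<in> critical_points"
proof
  assume "drift v = 0"
  from drift_eq_0_cases[OF this] show "torus_proj v \<in> critical_points"
  proof
    assume s: "sin (v $ 1) = 0 \<and> sin (v $ 2) = 0"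
    then have "cos (v $ 1) = 1 \<or> cos (v $ 1) = - 1" "cos (v $ 2) = 1 \<or> cos (v $ 2) = - 1"
      using sin_zero_abs_cos_one[of "v $ 1"] sin_zero_abs_cos_one[of "v $ 2"] by linarith+
    then show ?thesis using s by (auto simp: critical_points_def torus_proj_eq_torus_pt_iff)
  next
    assume c: "cos (v $ 1) = - 1 / 2 \<and> cos (v $ 2) = - 1 / 2 \<and> sin (v $ 2) = - sin (v $ 1)"
    have "(sin (v $ 1))\<^sup>2 = (sqrt 3 / 2)\<^sup>2" using c by (simp add: sin_squared_eq power_divide)
    then have "sin (v $ 1) = sqrt 3 / 2 \<or> sin (v $ 1) = - (sqrt 3 / 2)" by (simp only: power2_eq_iff)
    then show ?thesis
      using c by (auto simp: critical_points_def torus_proj_eq_torus_pt_iff cos_120 sin_120 cos_240 sin_240)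
  qed
next
  assume "torus_proj v \<in> critical_points"
  then show "drift v = 0"
    by (auto simp: critical_points_def torus_proj_eq_torus_pt_iff drift_def sin_diff vec_eq_iff
        forall_2 cos_120 sin_120 cos_240 sin_240)
qed

lemma card_critical_points: "card critical_points = 6"
  by (simp add: critical_points_def torus_proj_eq_torus_pt_iff cos_120 sin_120 cos_240 sin_240)

text \<open>The cosines determine the Jacobian at the zero, and the value of the potential tells the
  three types apart.\<close>

lemma drift_eq_0_types:
  assumes "drift v = 0"
  obtains (sink) "cos (v $ 1) = - 1 / 2" "cos (v $ 2) = - 1 / 2" "cos (v $ 1 - v $ 2) = - 1 / 2"
      "potential v = 3 / 2"
    | (source) "cos (v $ 1) = 1" "cos (v $ 2) = 1" "cos (v $ 1 - v $ 2) = 1" "potential v = - 3"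
    | (saddle) "sin (v $ 1) = 0" "sin (v $ 2) = 0" "potential v = 1"
      "(cos (v $ 1), cos (v $ 2)) \<in> {(1, - 1), (- 1, 1), (- 1, - 1)}"
proof -
  from drift_eq_0_cases[OF assms] show thesis
  proof (elim disjE)
    assume s: "sin (v $ 1) = 0 \<and> sin (v $ 2) = 0"
    then have "cos (v $ 1) = 1 \<or> cos (v $ 1) = - 1" "cos (v $ 2) = 1 \<or> cos (v $ 2) = - 1"
      using sin_zero_abs_cos_one[of "v $ 1"] sin_zero_abs_cos_one[of "v $ 2"] by linarith+
    then show thesis using s saddle source by (auto simp: potential_def cos_diff)
  next
    assume c: "cos (v $ 1) = - 1 / 2 \<and> cos (v $ 2) = - 1 / 2 \<and> sin (v $ 2) = - sin (v $ 1)"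
    have "(sin (v $ 1))\<^sup>2 = 3 / 4" using c by (simp add: sin_squared_eq power_divide)
    then have "cos (v $ 1 - v $ 2) = - 1 / 2" using c by (simp add: cos_diff power2_eq_square)
    then show thesis using c sink by (simp add: potential_def)
  qed
qed

section \<open>Continuity of the Jacobians\<close>

lemma continuous_on_matrix2:
  fixes J :: "'a::topological_space \<Rightarrow> real^2^2"
  assumes "\<And>i j. continuous_on A (\<lambda>x. J x $ i $ j)"
  shows "continuous_on A J"
proof -
  have "continuous_on A (\<lambda>x. \<chi> i j. J x $ i $ j)" by (intro continuous_on_vec_lambda assms)
  then show ?thesis by simp
qed

lemma continuous_on_G_jac: "continuous_on UNIV (G_jac a)"
proof (rule continuous_on_matrix2)
  show "continuous_on UNIV (\<lambda>v. G_jac a v $ i $ j)" for i j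
    using exhaust_2[of i] exhaust_2[of j]
    by (elim disjE; simp add: G_jac_def Let_def; intro continuous_intros)
qed

lemma continuous_on_inverse_matrix2:
  fixes J :: "real^2 \<Rightarrow> real^2^2"
  assumes "continuous_on A J" and "\<And>x. x \<in> A \<Longrightarrow> det (J x) \<noteq> 0"
  shows "continuous_on A (\<lambda>x. (1 / det (J x)) *\<^sub>R adj2 (J x))"
proof -
  have e: "continuous_on A (\<lambda>x. J x $ i $ j)" for i j by (intro continuous_intros assms)
  have "continuous_on A (\<lambda>x. det (J x))" unfolding det_2 by (intro continuous_intros e)
  then have "continuous_on A (\<lambda>x. 1 / det (J x))" using assms(2) by (intro continuous_intros) auto
  moreover have "continuous_on A (\<lambda>x. adj2 (J x))"
  proof (rule continuous_on_matrix2)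
    show "continuous_on A (\<lambda>x. adj2 (J x) $ i $ j)" for i j
      using exhaust_2[of i] exhaust_2[of j] by (elim disjE; simp) (intro continuous_on_minus e)+
  qed
  ultimately show ?thesis by (rule continuous_on_scaleR)
qed

lemma attracted_tangent_vector:
  assumes lift: "\<And>v. f (torus_proj v) = torus_proj (g v)"
    and der: "(g has_derivative L) (at l)" and fix_l: "g l = l"
    and cont: "continuous_on UNIV g" and inv: "\<And>y. y \<in> T \<Longrightarrow> g y \<in> T"
    and contr: "\<And>y. y \<in> T \<Longrightarrow> L (y - l) = c *\<^sub>R (y - l)" "\<bar>c\<bar> < 1"
    and v: "\<And>t. v + t *\<^sub>R u \<in> T" "(\<lambda>n. (g ^^ n) v) \<longlonglongrightarrow> l"
  shows "u \<in> stable_tangent_space f (torus_proj l) (torus_proj v)"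
proof -
  have "v \<in> T" using v(1)[of 0] by simp
  then obtain d where d: "d > 0"
    "\<And>U. open U \<Longrightarrow> l \<in> U \<Longrightarrow> \<forall>\<^sub>F n in sequentially. \<forall>y\<in>T \<inter> ball v d. (g ^^ n) y \<in> U"
    using uniform_attraction[OF der fix_l contr inv cont _ v(2)] by blast
  show ?thesis
    by (rule stable_tangent_spaceI[where g = g and T = T and d = d]) (simp_all add: lift fix_l v(1) d)
qed

section \<open>The torus map and its inverse\<close>

context small_step
begin

abbreviation "G \<equiv> G_map a"

lemma H_lift_cong:
  assumes "lattice_equiv v w" shows "lattice_equiv (H_lift v) (H_lift w)"
proof -
  \<comment> \<open>The drift is lattice periodic, so the lift commutes with the translation by
    \<open>v - w\<close>. Hence \<open>z\<close> is a preimage of \<open>v\<close> and equals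
    \<open>H_lift v\<close>.\<close>
  define z where "z = H_lift w + (v - w)"
  have z: "lattice_equiv z (H_lift w)"
    using assms by (simp add: z_def lattice_equiv_iff_diff[of "_ + _"] flip: lattice_equiv_iff_diff)
  have "G_lift a z = G_lift a (H_lift w) + (v - w)"
    unfolding G_lift_eq drift_cong[OF z] unfolding z_def by simp
  then have "G_lift a z = v" by simp
  then have "z = H_lift v" by auto
  then show ?thesis using z by simp
qed

lemma bij_G: "bij G"
proof (rule bijI)
  show "inj G"
  proof (rule injI)
    fix p q assume eq: "G p = G q"
    obtain v w where vw: "p = torus_proj v" "q = torus_proj w" by (metis torus_cases)
    from eq have "lattice_equiv (G_lift a v) (G_lift a w)"
      by (simp add: vw G_map_torus_proj torus_proj_eq_iff)
    from H_lift_cong[OF this] show "p = q" by (simp add: vw torus_proj_eq_iff)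
  qed
  show "surj G"
    by (rule surjI[of _ "\<lambda>p. torus_proj (H_lift (SOME v. torus_proj v = p))"])
       (metis (mono_tags, lifting) G_H_lift G_map_torus_proj someI_ex torus_cases)
qed

lemma inv_G_torus_proj: "inv G (torus_proj v) = torus_proj (H_lift v)"
  using bij_G by (metis G_H_lift G_map_torus_proj bij_is_inj inv_f_f)

lemma G_iterate: "(G ^^ n) (torus_proj v) = torus_proj ((G_lift a ^^ n) v)"
  by (induction n) (simp_all add: G_map_torus_proj)

lemma inv_G_iterate: "(inv G ^^ n) (torus_proj v) = torus_proj ((H_lift ^^ n) v)"
  by (induction n) (simp_all add: inv_G_torus_proj)

lemma H_jac_cong: "lattice_equiv v w \<Longrightarrow> H_jac v = H_jac w"
  using G_jac_cong[OF H_lift_cong] by (simp add: H_jac_def)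

lemma continuous_on_H_jac: "continuous_on UNIV H_jac"
  unfolding H_jac_def
  by (intro continuous_on_inverse_matrix2 det_G_jac_nz
      continuous_on_compose2[OF continuous_on_G_jac continuous_on_H_lift]) auto

lemma torus_C1_diffeo_G: "torus_C1_diffeo G"
  unfolding torus_C1_diffeo_def
  using torus_C1I[OF G_map_torus_proj has_derivative_G_lift G_jac_cong continuous_on_G_jac]
    torus_C1I[OF inv_G_torus_proj has_derivative_H_lift H_jac_cong continuous_on_H_jac] bij_G
  by blast

lemma G_fixed_point: "drift v = 0 \<Longrightarrow> G (torus_proj v) = torus_proj v"
  by (simp add: G_map_torus_proj G_lift_eq)

lemma H_lift_fixed_point: "drift v = 0 \<Longrightarrow> H_lift v = v"
  using H_G_lift[of v] by (simp add: G_lift_eq)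

lemma inv_G_fixed_point: "drift v = 0 \<Longrightarrow> inv G (torus_proj v) = torus_proj v"
  by (simp add: inv_G_torus_proj H_lift_fixed_point)

section \<open>Periodic and nonwandering points\<close>

lemma potential_iterate_ge: "m \<le> n \<Longrightarrow> potential ((G_lift a ^^ m) v) \<le> potential ((G_lift a ^^ n) v)"
  by (rule lift_Suc_mono_le[of "\<lambda>n. potential ((G_lift a ^^ n) v)"]) (simp_all add: potential_le_G_lift)

lemma potential_iterate_H_le: "potential ((H_lift ^^ n) v) \<le> potential v"
proof (induction n)
  case (Suc n)
  then show ?case using potential_le_G_lift[of "H_lift ((H_lift ^^ n) v)"] by simp
qed simp

lemma potential_tendsto: "X \<longlonglongrightarrow> l \<Longrightarrow> (\<lambda>n. potential (X n)) \<longlonglongrightarrow> potential l"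
  by (rule continuous_on_tendsto_compose[OF continuous_on_potential[OF continuous_on_id[of UNIV]]]) auto

text \<open>The potential descends to the torus, so a return to the starting point restores its
  value, which a first step off the zeros would have raised strictly.\<close>

lemma periodic_point_iff: "periodic_point G (torus_proj v) \<longleftrightarrow> drift v = 0"
proof
  assume "drift v = 0"
  then show "periodic_point G (torus_proj v)"
    unfolding periodic_point_def by (intro exI[of _ 1]) (simp add: G_fixed_point)
next
  assume "periodic_point G (torus_proj v)"
  then obtain n where n: "n > 0" "lattice_equiv ((G_lift a ^^ n) v) v"
    by (auto simp: periodic_point_def G_iterate torus_proj_eq_iff)
  show "drift v = 0"
  proof (rule ccontr)
    assume "drift v \<noteq> 0"
    then have "potential v < potential (G_lift a v)" by (rule potential_less_G_lift)
    also have "\<dots> \<le> potential ((G_lift a ^^ n) v)" using potential_iterate_ge[of 1 n v] n(1) by simp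
    also have "\<dots> = potential v" by (rule potential_cong[OF n(2)])
    finally show False by simp
  qed
qed

lemma nonwandering_iff: "torus_proj v \<in> nonwandering_set G \<longleftrightarrow> drift v = 0"
proof
  assume "drift v = 0"
  then show "torus_proj v \<in> nonwandering_set G"
    unfolding nonwandering_set_def using G_fixed_point[of v]
    by (auto intro!: exI[of _ 1] simp: disjoint_iff) (metis imageI)
next
  assume nw: "torus_proj v \<in> nonwandering_set G"
  show "drift v = 0"
  proof (rule ccontr)
    assume "drift v \<noteq> 0"
    from dense[OF potential_less_G_lift[OF this]]
    obtain c where c: "potential v < c" "c < potential (G_lift a v)" by blast
    \<comment> \<open>Points of \<open>U\<close> cross the level \<open>c\<close> in one step, and
      no later iterate can fall below \<open>c\<close> again.\<close>
    define U where "U = torus_proj ` {w. potential w < c \<and> c < potential (G_lift a w)}"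
    \<comment> \<open>The defining conditions are lattice invariant, so openness of \<open>U\<close>
      can be checked in the plane.\<close>
    have "torus_proj -` U = {w. potential w < c} \<inter> {w. c < potential (G_lift a w)}"
    proof (intro set_eqI iffI)
      fix w assume "w \<in> torus_proj -` U"
      then obtain w' where w': "lattice_equiv w w'" "potential w' < c" "c < potential (G_lift a w')"
        by (auto simp: U_def torus_proj_eq_iff)
      then show "w \<in> {w. potential w < c} \<inter> {w. c < potential (G_lift a w)}"
        using potential_cong[OF w'(1)] potential_cong[OF lattice_equiv_G_lift[OF w'(1)]] by simp
    qed (auto simp: U_def)
    moreover have "open {w. potential w < c}" "open {w. c < potential (G_lift a w)}"
      by (intro open_Collect_less continuous_intros)+
    ultimately have "open U" by (simp add: open_torus_iff open_Int)
    moreover have "torus_proj v \<in> U" using c by (auto simp: U_def)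
    ultimately obtain n where n: "n > 0" "(G ^^ n) ` U \<inter> U \<noteq> {}"
      using nw unfolding nonwandering_set_def by blast
    then obtain w z where w: "c < potential (G_lift a w)" and z: "potential z < c"
      and eq: "lattice_equiv ((G_lift a ^^ n) w) z"
      by (auto simp: U_def G_iterate torus_proj_eq_iff)
    have "potential (G_lift a w) \<le> potential ((G_lift a ^^ n) w)"
      using potential_iterate_ge[of 1 n w] n(1) by simp
    then show False using w z potential_cong[OF eq] by simp
  qed
qed

lemma nonwandering_set_G: "nonwandering_set G = critical_points"
  by (metis (no_types) drift_eq_0_iff nonwandering_iff subsetI subset_antisym torus_cases)

section \<open>Tangent spaces at sinks, sources and saddles, and transversality\<close>

lemma sink_tangent:
  assumes l: "cos (l $ 1) = - 1 / 2" "cos (l $ 2) = - 1 / 2" "cos (l $ 1 - l $ 2) = - 1 / 2" "drift l = 0"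
    and v: "(\<lambda>n. (G_lift a ^^ n) v) \<longlonglongrightarrow> l"
  shows "u \<in> stable_tangent_space G (torus_proj l) (torus_proj v)"
proof (rule attracted_tangent_vector[where T = UNIV, OF G_map_torus_proj has_derivative_G_lift _ _ _ _ _ _ v])
  \<comment> \<open>With all three cosines equal to - 1 / 2 the Jacobian is scalar, so every
    direction is contracted alike and the whole plane can serve as \<open>T\<close>.\<close>
  show "G_jac a l *v (y - l) = (1 - 3 * a / 2) *\<^sub>R (y - l)" for y
    unfolding G_jac_mult l(1-3) by (simp add: vec_eq_iff forall_2 algebra_simps)
  show "\<bar>1 - 3 * a / 2\<bar> < 1" using a_pos a_less by (simp add: abs_less_iff)
  show "G_lift a l = l" by (simp add: G_lift_eq l)
qed (auto intro: continuous_on_G_lift[OF continuous_on_id])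

text \<open>All three cosines are 1, so the Jacobian is \<open>1 + 3 * a\<close> times the identity
  and the inverse contracts every direction alike.\<close>

lemma source_tangent:
  assumes l: "cos (l $ 1) = 1" "cos (l $ 2) = 1" "cos (l $ 1 - l $ 2) = 1" "drift l = 0"
    and v: "(\<lambda>n. (H_lift ^^ n) v) \<longlonglongrightarrow> l"
  shows "u \<in> unstable_tangent_space G (torus_proj l) (torus_proj v)"
  unfolding unstable_tangent_space_def
proof (rule attracted_tangent_vector[where T = UNIV, OF inv_G_torus_proj has_derivative_H_lift _ _ _ _ _ _ v])
  show "H_jac l *v (y - l) = (1 / (1 + 3 * a)) *\<^sub>R (y - l)" for y
  proof -
    have "G_jac a l *v (y - l) = (1 + 3 * a) *\<^sub>R (y - l)"
      unfolding G_jac_mult l(1-3) by (simp add: vec_eq_iff forall_2 algebra_simps)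
    then have "G_jac a l *v ((1 / (1 + 3 * a)) *\<^sub>R (y - l)) = y - l"
      using a_pos by (simp add: matrix_vector_mult_scaleR)
    then show ?thesis using H_jac_mult[of l "(1 / (1 + 3 * a)) *\<^sub>R (y - l)"]
      by (simp add: H_lift_fixed_point[OF l(4)])
  qed
  show "\<bar>1 / (1 + 3 * a)\<bar> < 1" using a_pos by simp
  show "H_lift l = l" by (rule H_lift_fixed_point[OF l(4)])
qed (auto intro: continuous_on_H_lift)

lemma stable_line_tangent:
  assumes v: "drift v = 0" and eig: "G_jac a v *v s = (1 - 3 * a) *\<^sub>R s"
    and line: "\<And>t. G_lift a (v + t *\<^sub>R s) = v + \<phi> t *\<^sub>R s"
  shows "r *\<^sub>R s \<in> stable_tangent_space G (torus_proj v) (torus_proj v)"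
proof (rule attracted_tangent_vector[OF G_map_torus_proj has_derivative_G_lift])
  let ?T = "range (\<lambda>t. v + t *\<^sub>R s)"
  show "G_lift a v = v" by (simp add: G_lift_eq v)
  then show "(\<lambda>n. (G_lift a ^^ n) v) \<longlonglongrightarrow> v" by (simp add: funpow_fixed_point)
  show "G_jac a v *v (y - v) = (1 - 3 * a) *\<^sub>R (y - v)" if "y \<in> ?T" for y
    using that by (auto simp: matrix_vector_mult_scaleR eig)
  show "\<bar>1 - 3 * a\<bar> < 1" using a_pos a_less by (simp add: abs_less_iff)
  show "G_lift a y \<in> ?T" if "y \<in> ?T" for y using that line by auto
  show "v + t *\<^sub>R r *\<^sub>R s \<in> ?T" for t by (auto intro!: image_eqI[of _ _ "t * r"])
qed (intro continuous_intros)

lemma unstable_line_tangent: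
  assumes v: "drift v = 0" and eig: "G_jac a v *v u = (1 + a) *\<^sub>R u"
    and line: "\<And>t. G_lift a (v + t *\<^sub>R u) = v + \<phi> t *\<^sub>R u"
    and \<phi>: "continuous_on UNIV \<phi>" "\<And>t. \<bar>\<phi> t - t\<bar> \<le> 1"
  shows "r *\<^sub>R u \<in> unstable_tangent_space G (torus_proj v) (torus_proj v)"
  unfolding unstable_tangent_space_def
proof (rule attracted_tangent_vector[OF inv_G_torus_proj has_derivative_H_lift])
  let ?T = "range (\<lambda>t. v + t *\<^sub>R u)"
  show Hv: "H_lift v = v" by (rule H_lift_fixed_point[OF v])
  then show "(\<lambda>n. (H_lift ^^ n) v) \<longlonglongrightarrow> v" by (simp add: funpow_fixed_point)
  have "H_jac v *v u = (1 / (1 + a)) *\<^sub>R u"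
    using H_jac_mult[of v "(1 / (1 + a)) *\<^sub>R u"] a_pos by (simp add: Hv matrix_vector_mult_scaleR eig)
  then show "H_jac v *v (y - v) = (1 / (1 + a)) *\<^sub>R (y - v)" if "y \<in> ?T" for y
    using that by (auto simp: matrix_vector_mult_scaleR)
  show "\<bar>1 / (1 + a)\<bar> < 1" using a_pos by simp
  show "H_lift y \<in> ?T" if y: "y \<in> ?T" for y
  proof -
    from y obtain t where t: "y = v + t *\<^sub>R u" by blast
    \<comment> \<open>The inverse preserves the line because \<open>\<phi>\<close> is onto: it moves
      points by at most 1, so it attains \<open>t\<close> between \<open>t - 1\<close> and
      \<open>t + 1\<close>.\<close>
    have "\<exists>t'\<ge>t - 1. t' \<le> t + 1 \<and> \<phi> t' = t"
      using \<phi>(2)[of "t - 1"] \<phi>(2)[of "t + 1"]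
      by (intro IVT' continuous_on_subset[OF \<phi>(1)]) auto
    then obtain t' where "\<phi> t' = t" by blast
    then have "G_lift a (v + t' *\<^sub>R u) = y" by (simp add: line t)
    then have "H_lift y = v + t' *\<^sub>R u" by auto
    then show ?thesis by blast
  qed
  show "v + t *\<^sub>R r *\<^sub>R u \<in> ?T" for t by (auto intro!: image_eqI[of _ _ "t * r"])
qed (rule continuous_on_H_lift)

text \<open>Each saddle lies on two invariant lines along eigenvectors for \<open>1 - 3 * a\<close>
  and \<open>1 + a\<close>. Their directions span the plane.\<close>

lemma saddle_transverse:
  assumes v: "sin (v $ 1) = 0" "sin (v $ 2) = 0" "drift v = 0"
    "(cos (v $ 1), cos (v $ 2)) \<in> {(1, - 1), (- 1, 1), (- 1, - 1)}"
  shows "\<exists>u w. z = u + w \<and> u \<in> stable_tangent_space G (torus_proj v) (torus_proj v) \<and>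
    w \<in> unstable_tangent_space G (torus_proj v) (torus_proj v)"
proof -
  \<comment> \<open>These are the restrictions of the lift to the two lines, measured from the
    saddle; the same formulas serve all three saddles.\<close>
  define \<phi> where "\<phi> t = t - 3 * a * sin t" for t
  define \<psi> where "\<psi> t = t + a * (sin (2 * t) - sin t)" for t
  have \<psi>: "continuous_on UNIV \<psi>" unfolding \<psi>_def by (intro continuous_intros)
  have \<psi>_near: "\<bar>\<psi> t - t\<bar> \<le> 1" for t
  proof -
    have "\<bar>sin (2 * t)\<bar> \<le> 1" "\<bar>sin t\<bar> \<le> 1" by simp_all
    then have "\<bar>sin (2 * t) - sin t\<bar> \<le> 2" by linarith
    then have "a * \<bar>sin (2 * t) - sin t\<bar> \<le> 1 / 3 * 2" using a_pos a_less by (intro mult_mono) auto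
    then show ?thesis using a_pos by (simp add: \<psi>_def abs_mult)
  qed
  have combine: ?thesis
    if "G_jac a v *v s = (1 - 3 * a) *\<^sub>R s" "\<And>t. G_lift a (v + t *\<^sub>R s) = v + \<phi> t *\<^sub>R s"
      "G_jac a v *v u = (1 + a) *\<^sub>R u" "\<And>t. G_lift a (v + t *\<^sub>R u) = v + \<psi> t *\<^sub>R u"
      "z = r *\<^sub>R s + q *\<^sub>R u" for s u r q
    using stable_line_tangent[OF v(3) that(1,2)]
      unstable_line_tangent[OF v(3) that(3,4) \<psi> \<psi>_near] that(5) by blast
  have d: "sin ((v $ 1 + x) - (v $ 2 + y)) = sin ((v $ 1 - v $ 2) + (x - y))" for x y
    by (simp add: algebra_simps)
  consider "cos (v $ 1) = 1" "cos (v $ 2) = - 1" | "cos (v $ 1) = - 1" "cos (v $ 2) = 1"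
    | "cos (v $ 1) = - 1" "cos (v $ 2) = - 1" using v(4) by auto
  then show ?thesis
  proof cases
    case 1
    show ?thesis
    proof (rule combine[of "vector [0, 1]" "vector [2, 1]" "z $ 2 - z $ 1 / 2" "z $ 1 / 2"])
      show "G_jac a v *v vector [0, 1] = (1 - 3 * a) *\<^sub>R vector [0, 1]"
        "G_jac a v *v vector [2, 1] = (1 + a) *\<^sub>R vector [2, 1]"
        using 1 v(1,2) by (simp_all add: G_jac_mult cos_diff vec_eq_iff forall_2)
      show "G_lift a (v + t *\<^sub>R vector [0, 1]) = v + \<phi> t *\<^sub>R vector [0, 1]"
        "G_lift a (v + t *\<^sub>R vector [2, 1]) = v + \<psi> t *\<^sub>R vector [2, 1]" for t
        using 1 v(1,2)
        by (simp_all add: G_lift_eq drift_def d sin_add sin_diff cos_diff vec_eq_iff forall_2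
            \<phi>_def \<psi>_def algebra_simps)
      show "z = (z $ 2 - z $ 1 / 2) *\<^sub>R vector [0, 1] + (z $ 1 / 2) *\<^sub>R vector [2, 1]"
        by (simp add: vec_eq_iff forall_2)
    qed
  next
    case 2
    show ?thesis
    proof (rule combine[of "vector [1, 0]" "vector [1, 2]" "z $ 1 - z $ 2 / 2" "z $ 2 / 2"])
      show "G_jac a v *v vector [1, 0] = (1 - 3 * a) *\<^sub>R vector [1, 0]"
        "G_jac a v *v vector [1, 2] = (1 + a) *\<^sub>R vector [1, 2]"
        using 2 v(1,2) by (simp_all add: G_jac_mult cos_diff vec_eq_iff forall_2)
      show "G_lift a (v + t *\<^sub>R vector [1, 0]) = v + \<phi> t *\<^sub>R vector [1, 0]"
        "G_lift a (v + t *\<^sub>R vector [1, 2]) = v + \<psi> t *\<^sub>R vector [1, 2]" for t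
        using 2 v(1,2)
        by (simp_all add: G_lift_eq drift_def d sin_add sin_diff cos_diff vec_eq_iff forall_2
            \<phi>_def \<psi>_def algebra_simps)
      show "z = (z $ 1 - z $ 2 / 2) *\<^sub>R vector [1, 0] + (z $ 2 / 2) *\<^sub>R vector [1, 2]"
        by (simp add: vec_eq_iff forall_2)
    qed
  next
    case 3
    show ?thesis
    proof (rule combine[of "vector [1, 1]" "vector [1, - 1]" "(z $ 1 + z $ 2) / 2" "(z $ 1 - z $ 2) / 2"])
      show "G_jac a v *v vector [1, 1] = (1 - 3 * a) *\<^sub>R vector [1, 1]"
        "G_jac a v *v vector [1, - 1] = (1 + a) *\<^sub>R vector [1, - 1]"
        using 3 v(1,2) by (simp_all add: G_jac_mult cos_diff vec_eq_iff forall_2)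
      show "G_lift a (v + t *\<^sub>R vector [1, 1]) = v + \<phi> t *\<^sub>R vector [1, 1]"
        "G_lift a (v + t *\<^sub>R vector [1, - 1]) = v + \<psi> t *\<^sub>R vector [1, - 1]" for t
        using 3 v(1,2)
        by (simp_all add: G_lift_eq drift_def d sin_add sin_diff cos_diff vec_eq_iff forall_2
            \<phi>_def \<psi>_def algebra_simps)
      show "z = ((z $ 1 + z $ 2) / 2) *\<^sub>R vector [1, 1] + ((z $ 1 - z $ 2) / 2) *\<^sub>R vector [1, - 1]"
        by (simp add: vec_eq_iff forall_2 field_simps)
    qed
  qed
qed

text \<open>Along the orbit of \<open>x\<close> the potential increases from its value at \<open>q\<close> to its value at \<open>p\<close>. Unless
  \<open>p\<close> is a sink or \<open>q\<close> is a source, the former is at least 1 and the latter at most 1,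
  so the orbit is constant and \<open>x\<close> is a saddle.\<close>

lemma transverse_G:
  assumes p: "periodic_point G p" and q: "periodic_point G q"
  shows "transverse_stable_unstable G p q"
  unfolding transverse_stable_unstable_def
proof (intro ballI)
  fix x assume x: "x \<in> stable_manifold G p \<inter> unstable_manifold G q"
  have fixed: "G p = p" "inv G q = q"
    using p q periodic_point_iff G_fixed_point inv_G_fixed_point by (metis torus_cases)+
  have xp: "(\<lambda>n. (G ^^ n) x) \<longlonglongrightarrow> p" and xq: "(\<lambda>n. (inv G ^^ n) x) \<longlonglongrightarrow> q"
    using x fixed by (simp_all add: unstable_manifold_def stable_manifold_fixed_point)
  obtain v where v: "x = torus_proj v" by (cases x rule: torus_cases)
  obtain l where l: "drift l = 0" "(\<lambda>n. (G_lift a ^^ n) v) \<longlonglongrightarrow> l" using G_orbit_converges by blast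
  obtain m where m: "drift m = 0" "(\<lambda>n. (H_lift ^^ n) v) \<longlonglongrightarrow> m" using H_orbit_converges by blast
  have pl: "p = torus_proj l"
    using LIMSEQ_unique[OF xp] tendsto_torus_proj[OF l(2)] by (simp add: v G_iterate)
  have qm: "q = torus_proj m"
    using LIMSEQ_unique[OF xq] tendsto_torus_proj[OF m(2)] by (simp add: v inv_G_iterate)
  \<comment> \<open>The zero vector completes the decomposition when the other tangent space is the
    whole plane.\<close>
  have 0: "0 \<in> stable_tangent_space G p x" "0 \<in> unstable_tangent_space G q x"
    unfolding unstable_tangent_space_def using fixed xp xq by (intro zero_in_stable_tangent_space; simp)+
  have "\<exists>u w. z = u + w \<and> u \<in> stable_tangent_space G p x \<and> w \<in> unstable_tangent_space G q x" for z
  proof -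
    consider (sink) "cos (l $ 1) = - 1 / 2" "cos (l $ 2) = - 1 / 2" "cos (l $ 1 - l $ 2) = - 1 / 2"
      | (source) "cos (m $ 1) = 1" "cos (m $ 2) = 1" "cos (m $ 1 - m $ 2) = 1"
      | (saddle) "potential l \<le> 1" "1 \<le> potential m"
      using drift_eq_0_types[OF l(1)] drift_eq_0_types[OF m(1)] by fastforce
    then show ?thesis
    proof cases
      case sink
      show ?thesis
        using sink_tangent[OF sink l] 0(2) by (intro exI[of _ z] exI[of _ 0]) (simp add: pl v)
    next
      case source
      show ?thesis
        using source_tangent[OF source m] 0(1) by (intro exI[of _ 0] exI[of _ z]) (simp add: qm v)
    next
      case saddle
      have up: "potential ((G_lift a ^^ k) v) \<le> potential l" for k
        using potential_iterate_ge by (intro LIMSEQ_le_const[OF potential_tendsto[OF l(2)]]) blast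
      have down: "potential m \<le> potential v"
        using potential_iterate_H_le by (intro LIMSEQ_le_const2[OF potential_tendsto[OF m(2)]]) blast
      have fixed_v: "drift v = 0"
      proof (rule ccontr)
        assume "drift v \<noteq> 0"
        from potential_less_G_lift[OF this] show False using up[of 1] down saddle by simp
      qed
      have "G_lift a v = v" by (simp add: G_lift_eq fixed_v)
      then have lv: "l = v"
        using LIMSEQ_unique[OF l(2), of v] by (simp add: funpow_fixed_point)
      have mv: "m = v"
        using LIMSEQ_unique[OF m(2), of v] by (simp add: funpow_fixed_point H_lift_fixed_point[OF fixed_v])
      have "potential v = 1" using saddle lv mv by simp
      with drift_eq_0_types[OF fixed_v]
      have "sin (v $ 1) = 0" "sin (v $ 2) = 0"
        "(cos (v $ 1), cos (v $ 2)) \<in> {(1, - 1), (- 1, 1), (- 1, - 1)}" by fastforce+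
      from saddle_transverse[OF this(1,2) fixed_v this(3)] show ?thesis
        unfolding pl qm v lv mv .
    qed
  qed
  then show "{u + w | u w. u \<in> stable_tangent_space G p x \<and> w \<in> unstable_tangent_space G q x} = UNIV"
    by blast
qed

section \<open>Multipliers and types of the fixed points\<close>

lemma multipliers_G: "multipliers G (torus_proj v) = complex_eigenvalues (\<lambda>h. G_jac a v *v h)"
  by (simp add: multipliers_def torus_has_derivative_unique[OF G_map_torus_proj has_derivative_G_lift G_jac_cong])

lemma hyperbolic_fixed_point_GI:
  assumes "drift v = 0" and "\<forall>c\<in>multipliers G (torus_proj v). cmod c \<noteq> 1"
  shows "hyperbolic_fixed_point G (torus_proj v)"
  using assms
  by (auto simp: hyperbolic_fixed_point_def G_fixed_point
      torus_has_derivative_unique[OF G_map_torus_proj has_derivative_G_lift G_jac_cong])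

text \<open>Equal cosines make the Jacobian scalar. The sinks have \<open>k = - 1 / 2\<close>, the
  source has \<open>k = 1\<close>.\<close>

lemma multipliers_eq_singleton:
  assumes "cos (v $ 1) = k" "cos (v $ 2) = k" "cos (v $ 1 - v $ 2) = k"
  shows "multipliers G (torus_proj v) = {of_real (1 + 3 * a * k)}"
proof -
  define r where "r = 1 + 3 * a * k"
  have "G_jac a v = vector [vector [r, 0], vector [0, r]]"
    by (simp add: G_jac_def assms r_def algebra_simps)
  then show ?thesis
    unfolding multipliers_G complex_eigenvalues_matrix r_def[symmetric] by auto
qed

lemma is_sink_G:
  assumes "drift v = 0" "cos (v $ 1) = - 1 / 2" "cos (v $ 2) = - 1 / 2" "cos (v $ 1 - v $ 2) = - 1 / 2"
  shows "is_sink G (torus_proj v)"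
proof -
  have "\<bar>1 + 3 * a * (- 1 / 2)\<bar> < 1" using a_pos a_less by (simp add: abs_less_iff)
  then have "\<forall>c\<in>multipliers G (torus_proj v). cmod c < 1"
    unfolding multipliers_eq_singleton[OF assms(2-4)] by (metis norm_of_real singletonD)
  then show ?thesis
    using hyperbolic_fixed_point_GI[OF assms(1)] by (fastforce simp: is_sink_def)
qed

lemma is_source_G:
  assumes "drift v = 0" "cos (v $ 1) = 1" "cos (v $ 2) = 1" "cos (v $ 1 - v $ 2) = 1"
  shows "is_source G (torus_proj v)"
proof -
  have "\<bar>1 + 3 * a * 1\<bar> > 1" using a_pos by simp
  then have "\<forall>c\<in>multipliers G (torus_proj v). cmod c > 1"
    unfolding multipliers_eq_singleton[OF assms(2-4)] by (metis norm_of_real singletonD)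
  then show ?thesis
    using hyperbolic_fixed_point_GI[OF assms(1)] by (fastforce simp: is_source_def)
qed

lemma is_saddle_G:
  assumes v: "drift v = 0" "sin (v $ 1) = 0" "sin (v $ 2) = 0"
    "(cos (v $ 1), cos (v $ 2)) \<in> {(1, - 1), (- 1, 1), (- 1, - 1)}"
  shows "is_saddle G (torus_proj v)"
proof -
  \<comment> \<open>The three saddles have different Jacobians but a common characteristic
    polynomial.\<close>
  have char_poly: "(of_real (G_jac a v $ 1 $ 1) - c) * (of_real (G_jac a v $ 2 $ 2) - c)
      - of_real (G_jac a v $ 1 $ 2 * G_jac a v $ 2 $ 1) =
      (c - of_real (1 + a)) * (c - of_real (1 - 3 * a))" for c :: complex
  proof -
    consider "G_jac a v = vector [vector [1 + a, 0], vector [a * 2, 1 - a * 3]]"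
      | "G_jac a v = vector [vector [1 - a * 3, a * 2], vector [0, 1 + a]]"
      | "G_jac a v = vector [vector [1 - a, - (a * 2)], vector [- (a * 2), 1 - a]]"
      using v by (auto simp: G_jac_def cos_diff)
    then show ?thesis by cases (simp_all add: algebra_simps)
  qed
  have m: "multipliers G (torus_proj v) = {of_real (1 + a), of_real (1 - 3 * a)}"
    unfolding multipliers_G complex_eigenvalues_matrix set_eq_iff mem_Collect_eq
    by (subst eq_iff_diff_eq_0) (simp only: char_poly mult_eq_0_iff right_minus_eq insert_iff empty_iff simp_thms)
  have c: "cmod (of_real (1 + a)) > 1" "cmod (of_real (1 - 3 * a)) < 1"
    unfolding norm_of_real using a_pos a_less by (simp_all add: abs_less_iff)
  then have "hyperbolic_fixed_point G (torus_proj v)"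
    by (intro hyperbolic_fixed_point_GI v(1)) (auto simp: m simp del: of_real_add of_real_diff)
  then show ?thesis
    using c unfolding is_saddle_def is_sink_def is_source_def m by (metis insertCI order_less_asym)
qed

end

theorem proposition1:
  fixes a :: real
  assumes "0 < a" and "a < 1 / 3"
  shows "morse_smale (G_map a) \<and>
         nonwandering_set (G_map a) =
           {torus_pt 0 pi, torus_pt pi 0, torus_pt pi pi,
            torus_pt (2 * pi / 3) (4 * pi / 3), torus_pt (4 * pi / 3) (2 * pi / 3),
            torus_pt 0 0} \<and>
         card (nonwandering_set (G_map a)) = 6 \<and>
         is_saddle (G_map a) (torus_pt 0 pi) \<and>
         is_saddle (G_map a) (torus_pt pi 0) \<and>
         is_saddle (G_map a) (torus_pt pi pi) \<and>
         is_sink (G_map a) (torus_pt (2 * pi / 3) (4 * pi / 3)) \<and>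
         is_sink (G_map a) (torus_pt (4 * pi / 3) (2 * pi / 3)) \<and>
         is_source (G_map a) (torus_pt 0 0)"
proof -
  interpret small_step a using assms by unfold_locales
  have drift0: "drift v = 0" if "torus_proj v \<in> critical_points" for v
    using that by (simp add: drift_eq_0_iff)
  have fixed: "G p = p" if "p \<in> critical_points" for p
    using that by (metis torus_cases drift0 G_fixed_point)
  have periodic: "periodic_point G p \<longleftrightarrow> p \<in> critical_points" for p
    by (metis torus_cases drift_eq_0_iff periodic_point_iff)
  have saddles: "is_saddle G (torus_pt 0 pi)" "is_saddle G (torus_pt pi 0)" "is_saddle G (torus_pt pi pi)"
    by (rule is_saddle_G; simp add: drift0 critical_points_def)+
  have sinks: "is_sink G (torus_pt (2 * pi / 3) (4 * pi / 3))"
    "is_sink G (torus_pt (4 * pi / 3) (2 * pi / 3))"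
    by (rule is_sink_G;
        simp add: drift0 critical_points_def cos_diff cos_120 sin_120 cos_240 sin_240)+
  have source: "is_source G (torus_pt 0 0)"
    by (rule is_source_G) (simp_all add: drift0 critical_points_def)
  have hyperbolic: "hyperbolic_periodic_point G p" if "p \<in> critical_points" for p
  proof -
    have "hyperbolic_fixed_point G p"
      using that saddles sinks source
      by (auto simp: critical_points_def is_saddle_def is_sink_def is_source_def)
    then show ?thesis
      using that by (simp add: hyperbolic_periodic_point_def periodic period_fixed_point fixed)
  qed
  \<comment> \<open>Every periodic point is fixed, so \<open>critical_points\<close> itself is the
    finite set of orbit representatives.\<close>
  have orbits: "(\<Union>p\<in>critical_points. forward_orbit G p) = critical_points"
    by (simp add: forward_orbit_fixed_point fixed)
  have limits: "(\<exists>p. periodic_point G p \<and> omega_limit_set G x = forward_orbit G p) \<and>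
      (\<exists>q. periodic_point G q \<and> alpha_limit_set G x = forward_orbit G q)" for x
  proof -
    obtain v where v: "x = torus_proj v" by (cases x rule: torus_cases)
    obtain l where l: "drift l = 0" "(\<lambda>n. (G_lift a ^^ n) v) \<longlonglongrightarrow> l" using G_orbit_converges by blast
    obtain m where m: "drift m = 0" "(\<lambda>n. (H_lift ^^ n) v) \<longlonglongrightarrow> m" using H_orbit_converges by blast
    have "omega_limit_set G x = {torus_proj l}"
      using tendsto_torus_proj[OF l(2)] by (intro omega_limit_set_of_tendsto) (simp add: v G_iterate)
    moreover have "alpha_limit_set G x = {torus_proj m}"
      unfolding alpha_limit_set_def
      using tendsto_torus_proj[OF m(2)] by (intro omega_limit_set_of_tendsto) (simp add: v inv_G_iterate)
    ultimately show ?thesis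
      using l(1) m(1) by (metis periodic_point_iff forward_orbit_fixed_point G_fixed_point)
  qed
  have "finite critical_points" by (simp add: critical_points_def)
  then have "morse_smale G"
    unfolding morse_smale_def
    using torus_C1_diffeo_G hyperbolic orbits nonwandering_set_G limits transverse_G by metis
  then show ?thesis
    using saddles sinks source card_critical_points by (simp add: nonwandering_set_G flip: critical_points_def)
qed

end
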